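(* Fix $\alpha>4$ and consider the sequence of load balancing systems operating under Join the Shortest Queue (JSQ), indexed by the number of servers $N$, described in the context (with total arrival rate $N(1-N^{-\alpha})$ and total service rate $N$). Let $\overline{\boldsymbol q}^{(N)}=(\overline q_1^{(N)},\dots,\overline q_N^{(N)})$ be the steady-state vector of queue lengths of the $N$-th system. Then $$N^{-\alpha}\sum_{i=1}^N \overline q_i^{(N)}\;\Rightarrow\;\Upsilon\qquad\text{as }N\to\infty,$$ where $\Rightarrow$ denotes convergence in distribution and $\Upsilon$ is an exponential random variable with mean $\frac{\sigma_a^2+\sigma_s^2}{2}$.
   Context: Model (for each $N$). A discrete-time system has $N$ parallel servers, each with its own infinite-buffer queue; time slots are $k\in\mathbb Z_+$. $q_i^{(N)}(k)\in\mathbb Z_+$ is the number of jobs in queue $i$ at the beginning of slot $k$. $a^{(N)}(k)\in\mathbb Z_+$ is the total number of arrivals in slot $k$, i.i.d. in $k$; $\boldsymbol s(k)=(s_1(k),\dots,s_N(k))\in\mathbb Z_+^N$ is the vector of potential services, i.i.d. in $k$. The sequences $\{a^{(N)}(k)\}_k$, $\{s_1(k)\}_k,\dots,\{s_N(k)\}_k$ are mutually independent, and in slot $k$ the variables $a^{(N)}(k),\boldsymbol s(k)$ are independent of the queue lengths up to and including $\boldsymbol q^{(N)}(k)$. There are finite constants $A_{\max},S_{\max}$, not depending on $N$, with $a^{(N)}(1)\le N A_{\max}$ and $s_i(1)\le S_{\max}$ for all $i$ almost surely. Moments: with $\alpha>0$ a fixed parameter and $\sigma_a^2,\sigma_s^2$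 constants not depending on $N$: $\mathbb E[s_i(1)]=1$, $\mathrm{Var}[s_i(1)]=\sigma_s^2$ for every $i$, $\mathbb E[a^{(N)}(1)]=N(1-N^{-\alpha})$, $\mathrm{Var}[a^{(N)}(1)]=N\sigma_a^2$. Routing (JSQ): all arrivals of slot $k$ are sent to one queue $i^*(k)\in\arg\min_{i} q_i^{(N)}(k)$, ties broken at random; so $a_i^{(N)}(k)=a^{(N)}(k)$ if $i=i^*(k)$ and $0$ otherwise. Dynamics: $q_i^{(N)}(k+1)=\max\{q_i^{(N)}(k)+a_i^{(N)}(k)-s_i(k),0\}$ for every $i$. Standing assumptions: $\mathbb P[a^{(N)}(k)-s_i(k)=0]>0$ for some $i$; the Markov chain $\{\boldsymbol q^{(N)}(k)\}_k$ on its countable state space (a subset of $\mathbb Z_+^N$) is irreducible, aperiodic and positive recurrent, and $\overline{\boldsymbol q}^{(N)}$ denotes a random vector with its stationary distribution (to which $\boldsymbol q^{(N)}(k)$ converges in distribution). *)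

theory Defs
  imports "HOL-Probability.Probability"
begin

section \<open>Markov chains on a countable state space\<close>

primrec n_step :: "('x \<Rightarrow> 'x pmf) \<Rightarrow> nat \<Rightarrow> 'x \<Rightarrow> 'x pmf" where
  "n_step K 0 x = return_pmf x"
| "n_step K (Suc n) x = bind_pmf (K x) (n_step K n)"

text \<open>
  \<open>first_passage K y n x\<close> is the probability that the chain with kernel \<open>K\<close>, started in \<open>x\<close>,
  visits \<open>y\<close> at time \<open>n\<close> but at none of the times \<open>1, \<dots>, n - 1\<close>. For \<open>x = y\<close> it is the
  distribution of the return time to \<open>x\<close>.
\<close>
primrec first_passage :: "('x \<Rightarrow> 'x pmf) \<Rightarrow> 'x \<Rightarrow> nat \<Rightarrow> 'x \<Rightarrow> real" where
  "first_passage K y 0 x = 0"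
| "first_passage K y (Suc n) x =
     (if n = 0 then pmf (K x) y
      else measure_pmf.expectation (K x) (\<lambda>z. if z = y then 0 else first_passage K y n z))"

definition irreducible_chain :: "'x set \<Rightarrow> ('x \<Rightarrow> 'x pmf) \<Rightarrow> bool" where
  "irreducible_chain E K \<longleftrightarrow> (\<forall>x\<in>E. \<forall>y\<in>E. \<exists>n. pmf (n_step K n x) y > 0)"

definition period :: "('x \<Rightarrow> 'x pmf) \<Rightarrow> 'x \<Rightarrow> nat" where
  "period K x = Gcd {n. n > 0 \<and> pmf (n_step K n x) x > 0}"

definition aperiodic_chain :: "'x set \<Rightarrow> ('x \<Rightarrow> 'x pmf) \<Rightarrow> bool" where
  "aperiodic_chain E K \<longleftrightarrow> (\<forall>x\<in>E. period K x = 1)"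

text \<open>The return time to each state is almost surely finite and has finite expectation.\<close>
definition positive_recurrent_chain :: "'x set \<Rightarrow> ('x \<Rightarrow> 'x pmf) \<Rightarrow> bool" where
  "positive_recurrent_chain E K \<longleftrightarrow>
     (\<forall>x\<in>E. (\<lambda>n. first_passage K x n x) sums 1 \<and> summable (\<lambda>n. real n * first_passage K x n x))"

definition stationary_distribution :: "'x set \<Rightarrow> ('x \<Rightarrow> 'x pmf) \<Rightarrow> 'x pmf \<Rightarrow> bool" where
  "stationary_distribution E K \<pi> \<longleftrightarrow> set_pmf \<pi> \<subseteq> E \<and> bind_pmf \<pi> K = \<pi>"

text \<open>
  The values of the kernel \<open>K\<close> outside of the state space \<open>E\<close> are irrelevant.
\<close>
locale markov_chain = prob_space M for M :: "'w measure" +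
  fixes E :: "'x set"
    and K :: "'x \<Rightarrow> 'x pmf"
    and X :: "nat \<Rightarrow> 'w \<Rightarrow> 'x"
  assumes countable_state_space: "countable E"
    and kernel_closed: "\<And>x. x \<in> E \<Longrightarrow> set_pmf (K x) \<subseteq> E"
    and X_measurable: "\<And>k. X k \<in> measurable M (count_space UNIV)"
    and X_in_state_space: "\<And>k. AE \<omega> in M. X k \<omega> \<in> E"
    and markov_property: "\<And>k x.
      prob {\<omega> \<in> space M. \<forall>j\<le>Suc k. X j \<omega> = x j} =
      prob {\<omega> \<in> space M. \<forall>j\<le>k. X j \<omega> = x j} * pmf (K (x k)) (x (Suc k))"

text \<open>\<open>Y\<close> is a random element (on its own probability space) with a stationary distribution.\<close>
definition steady_state :: "'x set \<Rightarrow> ('x \<Rightarrow> 'x pmf) \<Rightarrow> 'v measure \<Rightarrow> ('v \<Rightarrow> 'x) \<Rightarrow> bool" where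
  "steady_state E K P Y \<longleftrightarrow>
     prob_space P \<and> Y \<in> measurable P (count_space UNIV) \<and>
     (\<exists>\<pi>. stationary_distribution E K \<pi> \<and> distr P (count_space UNIV) Y = measure_pmf \<pi>)"


section \<open>The load balancing system under Join the Shortest Queue\<close>

text \<open>
  The servers are \<open>1, \<dots>, N\<close>. A vector of queue lengths is a function \<open>nat \<Rightarrow> nat\<close> that vanishes
  outside of \<open>{1..N}\<close>.
\<close>
definition shortest_queues :: "nat \<Rightarrow> (nat \<Rightarrow> nat) \<Rightarrow> nat set" where
  "shortest_queues N x = {i. is_arg_min x (\<lambda>i. i \<in> {1..N}) i}"

text \<open>
  \<open>a k\<close>: total arrivals in slot \<open>k\<close>; \<open>s i k\<close>: potential service of server \<open>i\<close> in slot \<open>k\<close>;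
  \<open>istar k\<close>: the queue to which the arrivals of slot \<open>k\<close> are sent; \<open>q k \<omega>\<close>: the vector of
  queue lengths at the beginning of slot \<open>k\<close>.

  Independence over slots together with mutual independence of the sequences
  \<open>a, s 1, \<dots>, s N\<close> is independence of the family of all \<open>a k\<close>, \<open>s i k\<close>; it is indexed
  by pairs \<open>(i, k)\<close>, where \<open>i = 0\<close> stands for the arrivals.

  Ties are broken uniformly at random: given the queue lengths up to slot \<open>k\<close>, the choice
  \<open>istar k\<close> is uniform on the shortest queues, and \<open>(a k, s 1 k, \<dots>, s N k)\<close> is independent of the
  queue lengths up to slot \<open>k\<close> and of this choice. As all these variables are discrete, the
  independence is expressed through their joint point probabilities.

  For \<open>N = 1\<close> the moment assumptions say that \<open>a k\<close> has mean \<open>0\<close>, so they force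
  \<open>\<sigma>\<^sub>a = 0\<close>. A sequence of systems with constant \<open>\<sigma>\<^sub>a\<close> therefore has to start at
  \<open>N = 2\<close>, where non-integrality of the mean of \<open>a k\<close> instead forces \<open>\<sigma>\<^sub>a \<noteq> 0\<close>.
\<close>
locale jsq_system = prob_space M for M :: "'w measure" +
  fixes N :: nat
    and \<alpha> \<sigma>\<^sub>a \<sigma>\<^sub>s A_max S_max :: real
    and a :: "nat \<Rightarrow> 'w \<Rightarrow> nat"
    and s :: "nat \<Rightarrow> nat \<Rightarrow> 'w \<Rightarrow> nat"
    and istar :: "nat \<Rightarrow> 'w \<Rightarrow> nat"
    and q :: "nat \<Rightarrow> 'w \<Rightarrow> nat \<Rightarrow> nat"
  assumes indep_primitives:
      "indep_vars (\<lambda>_. count_space UNIV)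
         (\<lambda>(i, k). if i = 0 then a k else s i k) ({0..N} \<times> UNIV)"
    and a_identically_distributed:
      "\<And>k. distr M (count_space UNIV) (a k) = distr M (count_space UNIV) (a 1)"
    and s_identically_distributed:
      "\<And>i k. i \<in> {1..N} \<Longrightarrow>
         distr M (count_space UNIV) (s i k) = distr M (count_space UNIV) (s i 1)"
    and a_bounded: "AE \<omega> in M. real (a 1 \<omega>) \<le> real N * A_max"
    and s_bounded: "\<And>i. i \<in> {1..N} \<Longrightarrow> AE \<omega> in M. real (s i 1 \<omega>) \<le> S_max"
    and expectation_a: "expectation (\<lambda>\<omega>. real (a 1 \<omega>)) = real N * (1 - real N powr (-\<alpha>))"
    and variance_a: "variance (\<lambda>\<omega>. real (a 1 \<omega>)) = real N * \<sigma>\<^sub>a\<^sup>2"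
    and expectation_s: "\<And>i. i \<in> {1..N} \<Longrightarrow> expectation (\<lambda>\<omega>. real (s i 1 \<omega>)) = 1"
    and variance_s: "\<And>i. i \<in> {1..N} \<Longrightarrow> variance (\<lambda>\<omega>. real (s i 1 \<omega>)) = \<sigma>\<^sub>s\<^sup>2"
    and q_support: "\<And>k \<omega> i. \<omega> \<in> space M \<Longrightarrow> i \<notin> {1..N} \<Longrightarrow> q k \<omega> i = 0"
    and q_measurable: "\<And>k. q k \<in> measurable M (count_space UNIV)"
    and istar_measurable: "\<And>k. istar k \<in> measurable M (count_space UNIV)"
    and indep_past:
      "\<And>k x i n v.
         prob {\<omega> \<in> space M. ((\<forall>j\<le>k. q j \<omega> = x j) \<and> istar k \<omega> = i) \<and>
                           (a k \<omega> = n \<and> (\<forall>l\<in>{1..N}. s l k \<omega> = v l))} =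
         prob {\<omega> \<in> space M. (\<forall>j\<le>k. q j \<omega> = x j) \<and> istar k \<omega> = i} *
         prob {\<omega> \<in> space M. a k \<omega> = n \<and> (\<forall>l\<in>{1..N}. s l k \<omega> = v l)}"
    and jsq_routing: "\<And>k \<omega>. \<omega> \<in> space M \<Longrightarrow> istar k \<omega> \<in> shortest_queues N (q k \<omega>)"
    and random_ties:
      "\<And>k x i. i \<in> shortest_queues N (x k) \<Longrightarrow>
         prob {\<omega> \<in> space M. (\<forall>j\<le>k. q j \<omega> = x j) \<and> istar k \<omega> = i} =
         prob {\<omega> \<in> space M. \<forall>j\<le>k. q j \<omega> = x j} / real (card (shortest_queues N (x k)))"
    and dynamics:
      "\<And>k \<omega> i. \<omega> \<in> space M \<Longrightarrow> i \<in> {1..N} \<Longrightarrow>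
         int (q (Suc k) \<omega> i) =
         max (int (q k \<omega> i) + int (if i = istar k \<omega> then a k \<omega> else 0) - int (s i k \<omega>)) 0"
    and arrivals_eq_service: "\<exists>i\<in>{1..N}. \<forall>k. prob {\<omega> \<in> space M. int (a k \<omega>) - int (s i k \<omega>) = 0} > 0"

end

theory Submission
  imports Defs "HOL-Real_Asymp.Real_Asymp"
begin

text \<open>
  Write \<open>\<epsilon> = N\<^sup>-\<^sup>\<alpha>\<close>, let \<open>Q\<close> be the total queue length in steady state, \<open>A - S\<close> the net input and \<open>U\<close> the
  unused service of a slot, so that the next total is \<open>Q' = Q + A - S + U\<close>. With \<open>\<theta> = t \<epsilon>\<close>,
  stationarity applied to
  \<open>e\<^sup>i\<^sup>\<theta>\<^sup>(\<^sup>Q\<^sup>+\<^sup>A\<^sup>-\<^sup>S\<^sup>) = e\<^sup>i\<^sup>\<theta>\<^sup>Q\<^sup>' + e\<^sup>-\<^sup>i\<^sup>\<theta>\<^sup>U - 1 + (e\<^sup>i\<^sup>\<theta>\<^sup>Q\<^sup>' - 1) (e\<^sup>-\<^sup>i\<^sup>\<theta>\<^sup>U - 1)\<close>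
  and division by \<open>N \<epsilon>\<^sup>2\<close> give
  \<open>\<phi>(t) (i t + t\<^sup>2 (\<sigma>\<^sub>a\<^sup>2 + \<sigma>\<^sub>s\<^sup>2) / 2) = i t + o(1)\<close> for the characteristic function \<open>\<phi>\<close> of \<open>\<epsilon> Q\<close>, because
  \<open>E U = N \<epsilon>\<close>, provided that the last product is negligible. It vanishes unless \<open>U > 0\<close>, and then
  some queue is empty after the slot, so that \<open>Q'\<close> is at most \<open>N\<close> times the distance \<open>W\<close> of the queue lengths
  from their average. Routing to the shortest queue gives \<open>W\<close> a drift of at most
  \<open>-1/8\<close> outside of a ball of radius \<open>O(N\<^sup>2)\<close>, with increments \<open>O(N)\<close>; so \<open>W\<close> has an exponential
  tail on the scale \<open>N\<^sup>2\<close> and is rarely above \<open>N\<^sup>3\<close>. At this threshold the product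
  contributes \<open>O(N\<^sup>4 \<epsilon>)\<close>, which is where \<open>\<alpha> > 4\<close> enters.
\<close>

section \<open>Spread of a vector around its average\<close>

definition avg :: "'i set \<Rightarrow> ('i \<Rightarrow> real) \<Rightarrow> real" where
  "avg I x = sum x I / real (card I)"

text \<open>The Euclidean distance of \<open>x\<close> from the line of constant vectors, that is,
  the norm of its component orthogonal to the all-ones direction. State space collapse means that
  this component stays small for the queue lengths.\<close>

definition spread :: "'i set \<Rightarrow> ('i \<Rightarrow> real) \<Rightarrow> real" where
  "spread I x = L2_set (\<lambda>i. x i - avg I x) I"

lemma spread_nonneg: "0 \<le> spread I x"
  by (simp add: spread_def)

lemma spread_square: "(spread I x)\<^sup>2 = (\<Sum>i\<in>I. (x i - avg I x)\<^sup>2)"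
  by (simp add: spread_def L2_set_def sum_nonneg)

lemma sum_diff_avg:
  assumes "finite I" "I \<noteq> {}"
  shows "(\<Sum>i\<in>I. x i - avg I x) = 0"
  using assms by (simp add: sum_subtractf avg_def)

lemma avg_add: "avg I (\<lambda>i. x i + y i) = avg I x + avg I y"
  by (simp add: avg_def sum.distrib add_divide_distrib)

lemma spread_cong:
  assumes "\<And>i. i \<in> I \<Longrightarrow> x i = y i"
  shows "spread I x = spread I y"
proof -
  have "avg I x = avg I y" using assms by (simp add: avg_def)
  then show ?thesis using assms by (auto simp: spread_def intro!: L2_set_cong)
qed

text \<open>Among all constants, the average minimises the sum of squared distances: in the
  expansion around the average the cross term vanishes, because the deviations sum to 0.\<close>

lemma spread_le_L2_set_diff:
  assumes "finite I" "I \<noteq> {}"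
  shows "spread I x \<le> L2_set (\<lambda>i. x i - c) I"
proof -
  have "(\<Sum>i\<in>I. (x i - c)\<^sup>2) = (\<Sum>i\<in>I. (x i - avg I x)\<^sup>2 + (avg I x - c)\<^sup>2
          + 2 * (avg I x - c) * (x i - avg I x))"
    by (intro sum.cong) (auto simp: power2_eq_square algebra_simps)
  also have "\<dots> = (\<Sum>i\<in>I. (x i - avg I x)\<^sup>2) + card I * (avg I x - c)\<^sup>2
          + 2 * (avg I x - c) * (\<Sum>i\<in>I. x i - avg I x)"
    by (simp add: sum.distrib sum_distrib_left)
  also have "\<dots> \<ge> (\<Sum>i\<in>I. (x i - avg I x)\<^sup>2)"
    using sum_diff_avg[OF assms] by simp
  finally show ?thesis
    by (simp add: spread_def L2_set_def)
qed

text \<open>Reflection at 0 is 1-Lipschitz, and by the minimality of the average it suffices to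
  compare the reflected vector with the reflected old average. Hence the drift of the spread can be
  estimated for the unreflected queues.\<close>

lemma spread_max_zero:
  assumes "finite I" "I \<noteq> {}"
  shows "spread I (\<lambda>i. max (x i) 0) \<le> spread I x"
proof -
  have "spread I (\<lambda>i. max (x i) 0) \<le> L2_set (\<lambda>i. max (x i) 0 - max (avg I x) 0) I"
    by (rule spread_le_L2_set_diff[OF assms])
  also have "\<dots> \<le> spread I x"
    unfolding spread_def L2_set_def
  proof (intro real_sqrt_le_mono sum_mono)
    fix i
    have "\<bar>max (x i) 0 - max (avg I x) 0\<bar> \<le> \<bar>x i - avg I x\<bar>" by linarith
    then show "(max (x i) 0 - max (avg I x) 0)\<^sup>2 \<le> (x i - avg I x)\<^sup>2"
      by (simp add: abs_le_square_iff)
  qed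
  finally show ?thesis .
qed

lemma spread_triangle: "spread I (\<lambda>i. x i + y i) \<le> spread I x + spread I y"
proof -
  have "spread I (\<lambda>i. x i + y i) = L2_set (\<lambda>i. (x i - avg I x) + (y i - avg I y)) I"
    unfolding spread_def avg_add by (rule arg_cong2[where f = L2_set]) auto
  also have "\<dots> \<le> spread I x + spread I y"
    unfolding spread_def by (rule L2_set_triangle_ineq)
  finally show ?thesis .
qed

lemma spread_uminus: "spread I (\<lambda>i. - x i) = spread I x"
proof -
  have "(- x i - avg I (\<lambda>i. - x i))\<^sup>2 = (x i - avg I x)\<^sup>2" for i
    by (simp add: avg_def sum_negf power2_eq_square algebra_simps)
  then show ?thesis by (simp add: spread_def L2_set_def)
qed

lemma abs_spread_diff_le: "\<bar>spread I (\<lambda>i. x i + y i) - spread I x\<bar> \<le> spread I y"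
proof -
  have "spread I (\<lambda>i. (x i + y i) + - y i) \<le> spread I (\<lambda>i. x i + y i) + spread I (\<lambda>i. - y i)"
    by (rule spread_triangle)
  then have "spread I x \<le> spread I (\<lambda>i. x i + y i) + spread I y"
    by (simp add: spread_uminus)
  then show ?thesis
    using spread_triangle[of I x y] by linarith
qed

lemma spread_le_sum_abs:
  assumes "finite I" "I \<noteq> {}"
  shows "spread I x \<le> (\<Sum>i\<in>I. \<bar>x i\<bar>)"
  using spread_le_L2_set_diff[OF assms, of x 0] L2_set_le_sum_abs[of x I] by simp

lemma spread_add_square:
  assumes "finite I" "I \<noteq> {}"
  shows "(spread I (\<lambda>i. x i + y i))\<^sup>2 =
    (spread I x)\<^sup>2 + 2 * (\<Sum>i\<in>I. (x i - avg I x) * y i) + (spread I y)\<^sup>2"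
proof -
  have "(spread I (\<lambda>i. x i + y i))\<^sup>2 = (\<Sum>i\<in>I. (x i - avg I x)\<^sup>2 + 2 * ((x i - avg I x) * y i)
      + (- 2 * avg I y) * (x i - avg I x) + (y i - avg I y)\<^sup>2)"
    unfolding spread_square avg_add by (intro sum.cong) (auto simp: power2_eq_square algebra_simps)
  also have "\<dots> = (spread I x)\<^sup>2 + 2 * (\<Sum>i\<in>I. (x i - avg I x) * y i)
      + (- 2 * avg I y) * (\<Sum>i\<in>I. x i - avg I x) + (spread I y)\<^sup>2"
    unfolding spread_square sum_distrib_left by (simp only: sum.distrib)
  finally show ?thesis using sum_diff_avg[OF assms] by simp
qed

text \<open>The deviations sum to 0, so subtracting them from their absolute values leaves the sum
  unchanged and turns each term into twice a negative part, which is at most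
  \<open>avg I x - m\<close>. Read backwards, this is a lower bound for the gap between the average
  and the shortest queue, the source of the drift under JSQ.\<close>

lemma spread_le_avg_minus_min:
  assumes "finite I" "I \<noteq> {}" and min: "\<And>i. i \<in> I \<Longrightarrow> m \<le> x i"
  shows "spread I x \<le> 2 * card I * (avg I x - m)"
proof -
  have m: "m \<le> avg I x"
  proof -
    have "card I * m \<le> sum x I"
      using sum_mono[of I "\<lambda>_. m" x] min by simp
    then show ?thesis using assms by (simp add: avg_def field_simps card_gt_0_iff)
  qed
  have "spread I x \<le> (\<Sum>i\<in>I. \<bar>x i - avg I x\<bar>)"
    unfolding spread_def by (rule L2_set_le_sum_abs)
  also have "\<dots> = (\<Sum>i\<in>I. \<bar>x i - avg I x\<bar> - (x i - avg I x))"
    using sum_diff_avg[OF assms(1,2)] by (simp add: sum_subtractf)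
  also have "\<dots> \<le> (\<Sum>i\<in>I. 2 * (avg I x - m))"
  proof (rule sum_mono)
    fix i assume "i \<in> I"
    then show "\<bar>x i - avg I x\<bar> - (x i - avg I x) \<le> 2 * (avg I x - m)"
      using min[OF \<open>i \<in> I\<close>] m by (cases "x i \<le> avg I x") (simp_all add: abs_if)
  qed
  finally show ?thesis by (simp add: mult_ac)
qed

text \<open>A coordinate equal to 0 deviates from the average by the average itself, and a single
  deviation is at most the Euclidean norm of all of them.\<close>

lemma sum_le_spread_if_zero:
  assumes "finite I" "i \<in> I" "x i = 0"
  shows "sum x I \<le> card I * spread I x"
proof -
  have "\<bar>x i - avg I x\<bar> \<le> spread I x"
    using member_le_L2_set[of I i "\<lambda>i. \<bar>x i - avg I x\<bar>"] assms
    by (simp add: spread_def L2_set_def)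
  then have "avg I x \<le> spread I x" using assms by simp
  then have "card I * avg I x \<le> card I * spread I x"
    by (intro mult_left_mono) auto
  moreover have "card I * avg I x = sum x I"
    using assms by (auto simp: avg_def)
  ultimately show ?thesis by simp
qed

section \<open>One slot of the dynamics\<close>

text \<open>Truncated subtraction on the natural numbers takes care of the maximum with \<open>0\<close>.\<close>
definition jsq_step :: "nat \<Rightarrow> (nat \<Rightarrow> nat) \<Rightarrow> nat \<Rightarrow> (nat \<Rightarrow> nat) \<Rightarrow> nat \<Rightarrow> nat" where
  "jsq_step N x i w j = (if j \<in> {1..N} then (x j + (if j = i then w 0 else 0)) - w j else 0)"

text \<open>In the input vector \<open>w\<close> of a slot, index 0 holds the total arrivals and
  index \<open>j\<close> in \<open>{1..N}\<close> the potential service of server \<open>j\<close>.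
  The net input may push a queue below 0; \<open>jsq_step\<close> is the reflected version.\<close>

definition net_input :: "nat \<Rightarrow> (nat \<Rightarrow> nat) \<Rightarrow> nat \<Rightarrow> real" where
  "net_input i w j = (if j = i then real (w 0) else 0) - real (w j)"

definition jobs :: "nat \<Rightarrow> (nat \<Rightarrow> nat) \<Rightarrow> real" where
  "jobs N x = (\<Sum>i=1..N. real (x i))"

definition total_net :: "nat \<Rightarrow> (nat \<Rightarrow> nat) \<Rightarrow> real" where
  "total_net N w = real (w 0) - jobs N w"

text \<open>Potential service that finds no job: the total amount by which the reflection at 0 lifts
  the queues.\<close>

definition unused :: "nat \<Rightarrow> (nat \<Rightarrow> nat) \<Rightarrow> nat \<Rightarrow> (nat \<Rightarrow> nat) \<Rightarrow> real" where
  "unused N x i w = (\<Sum>j=1..N. max (- (real (x j) + net_input i w j)) 0)"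

lemma real_jsq_step:
  assumes "j \<in> {1..N}"
  shows "real (jsq_step N x i w j) = max (real (x j) + net_input i w j) 0"
  using assms by (auto simp: jsq_step_def net_input_def max_def)

lemma jobs_jsq_step:
  assumes "i \<in> {1..N}"
  shows "jobs N (jsq_step N x i w) = jobs N x + total_net N w + unused N x i w"
proof -
  have "jobs N (jsq_step N x i w) =
      (\<Sum>j=1..N. real (x j) + net_input i w j + max (- (real (x j) + net_input i w j)) 0)"
    unfolding jobs_def by (intro sum.cong refl) (subst real_jsq_step, auto simp: max_def)
  also have "\<dots> = jobs N x + (\<Sum>j=1..N. net_input i w j) + unused N x i w"
    by (simp add: sum.distrib jobs_def unused_def)
  also have "(\<Sum>j=1..N. net_input i w j) = total_net N w"
    using assms by (simp add: net_input_def sum_subtractf total_net_def jobs_def)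
  finally show ?thesis .
qed

lemma unused_nonneg: "0 \<le> unused N x i w"
  by (simp add: unused_def sum_nonneg)

lemma unused_le_jobs: "unused N x i w \<le> jobs N w"
  unfolding unused_def jobs_def by (intro sum_mono) (auto simp: net_input_def)

lemma jsq_step_eq_zero_if_unused_pos:
  assumes "0 < unused N x i w"
  obtains j where "j \<in> {1..N}" "jsq_step N x i w j = 0"
proof -
  obtain j where j: "j \<in> {1..N}" "max (- (real (x j) + net_input i w j)) 0 \<noteq> 0"
    using assms unfolding unused_def
    by (auto elim!: sum.not_neutral_contains_not_neutral[OF less_imp_neq[symmetric]])
  then have "real (jsq_step N x i w j) = 0"
    by (subst real_jsq_step) (auto simp: max_def split: if_splits)
  with j show ?thesis by (intro that) auto
qed

lemma jobs_le_spread_if_unused_pos: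
  assumes "0 < unused N x i w"
  shows "jobs N (jsq_step N x i w) \<le> N * spread {1..N} (\<lambda>j. jsq_step N x i w j)"
proof -
  obtain j where "j \<in> {1..N}" "jsq_step N x i w j = 0"
    using assms by (rule jsq_step_eq_zero_if_unused_pos)
  then show ?thesis
    using sum_le_spread_if_zero[of "{1..N}" j "\<lambda>j. jsq_step N x i w j"] by (simp add: jobs_def)
qed

lemma spread_jsq_step:
  assumes "0 < N"
  shows "spread {1..N} (\<lambda>j. jsq_step N x i w j) \<le> spread {1..N} (\<lambda>j. x j + net_input i w j)"
proof -
  have "spread {1..N} (\<lambda>j. jsq_step N x i w j) = spread {1..N} (\<lambda>j. max (x j + net_input i w j) 0)"
    by (rule spread_cong) (rule real_jsq_step)
  with spread_max_zero[of "{1..N}"] assms show ?thesis by auto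
qed

lemma sum_abs_net_input_le:
  assumes "i \<in> {1..N}"
  shows "(\<Sum>j=1..N. \<bar>net_input i w j\<bar>) \<le> real (w 0) + jobs N w"
proof -
  have "(\<Sum>j=1..N. \<bar>net_input i w j\<bar>) \<le> (\<Sum>j=1..N. (if j = i then real (w 0) else 0) + real (w j))"
    by (intro sum_mono) (auto simp: net_input_def)
  also have "\<dots> = real (w 0) + jobs N w"
    using assms by (simp add: sum.distrib jobs_def)
  finally show ?thesis .
qed

section \<open>Drift of the spread\<close>

lemma integrable_measure_pmf_bounded:
  fixes f :: "'a \<Rightarrow> 'b::{banach, second_countable_topology}"
  assumes "\<And>x. x \<in> set_pmf p \<Longrightarrow> norm (f x) \<le> c"
  shows "integrable (measure_pmf p) f"
  using assms by (intro measure_pmf.integrable_const_bound[of _ c]) (auto simp: AE_measure_pmf_iff)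

text \<open>Fubini's theorem, taken from Tonelli's for nonnegative functions. The real version below
  follows by adding the constant \<open>c\<close>, the complex one by splitting into real and
  imaginary parts.\<close>

lemma expectation_pair_pmf_nonneg:
  fixes f :: "'a \<times> 'b \<Rightarrow> real"
  assumes nonneg: "\<And>z. 0 \<le> f z"
    and bound: "\<And>a b. a \<in> set_pmf p \<Longrightarrow> b \<in> set_pmf q \<Longrightarrow> f (a, b) \<le> c"
  shows "measure_pmf.expectation (pair_pmf p q) f =
    measure_pmf.expectation p (\<lambda>a. measure_pmf.expectation q (\<lambda>b. f (a, b)))"
proof -
  have int: "integrable (measure_pmf q) (\<lambda>b. f (a, b))" if "a \<in> set_pmf p" for a
    using bound[OF that] nonneg by (intro integrable_measure_pmf_bounded[of _ _ c]) auto
  have le: "measure_pmf.expectation q (\<lambda>b. f (a, b)) \<le> c" if "a \<in> set_pmf p" for a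
    using bound[OF that] int[OF that]
    by (intro measure_pmf.integral_le_const) (auto simp: AE_measure_pmf_iff)
  have "ennreal (measure_pmf.expectation (pair_pmf p q) f) = (\<integral>\<^sup>+ z. f z \<partial>pair_pmf p q)"
    using nonneg bound
    by (intro nn_integral_eq_integral[symmetric] integrable_measure_pmf_bounded[of _ _ c]) auto
  also have "\<dots> = (\<integral>\<^sup>+ a. \<integral>\<^sup>+ b. f (a, b) \<partial>q \<partial>p)"
    by (rule nn_integral_pair_pmf')
  also have "\<dots> = (\<integral>\<^sup>+ a. ennreal (measure_pmf.expectation q (\<lambda>b. f (a, b))) \<partial>p)"
    using int nonneg
    by (intro nn_integral_cong_AE) (auto simp: AE_measure_pmf_iff intro!: nn_integral_eq_integral)
  also have "\<dots> = ennreal (measure_pmf.expectation p (\<lambda>a. measure_pmf.expectation q (\<lambda>b. f (a, b))))"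
    using nonneg le
    by (intro nn_integral_eq_integral integrable_measure_pmf_bounded[of _ _ c]) auto
  finally show ?thesis
    using nonneg by (simp add: integral_nonneg_AE)
qed

lemma expectation_pair_pmf_real:
  fixes f :: "'a \<times> 'b \<Rightarrow> real"
  assumes bound: "\<And>z. \<bar>f z\<bar> \<le> c"
  shows "measure_pmf.expectation (pair_pmf p q) f =
    measure_pmf.expectation p (\<lambda>a. measure_pmf.expectation q (\<lambda>b. f (a, b)))"
proof -
  have int: "integrable (measure_pmf r) g" if "\<And>z. \<bar>g z\<bar> \<le> c" for g :: "'z \<Rightarrow> real" and r
    using that by (intro integrable_measure_pmf_bounded[of _ _ c]) auto
  have le: "\<bar>measure_pmf.expectation q (\<lambda>b. f (a, b))\<bar> \<le> c" for a
    using measure_pmf.integral_le_const[OF int, of "\<lambda>b. f (a, b)" c q]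
      measure_pmf.integral_ge_const[OF int, of "\<lambda>b. f (a, b)" "- c" q] bound
    by (auto simp: abs_le_iff minus_le_iff)
  have "f z + c \<ge> 0" "f z + c \<le> 2 * c" for z using bound[of z] by auto
  then have "measure_pmf.expectation (pair_pmf p q) (\<lambda>z. f z + c) =
    measure_pmf.expectation p (\<lambda>a. measure_pmf.expectation q (\<lambda>b. f (a, b) + c))"
    by (intro expectation_pair_pmf_nonneg[of _ _ _ "2 * c"])
  then show ?thesis
    by (simp add: int[OF bound] int[OF le])
qed

lemma expectation_pair_pmf_complex:
  fixes f :: "'a \<times> 'b \<Rightarrow> complex"
  assumes bound: "\<And>z. norm (f z) \<le> c"
  shows "measure_pmf.expectation (pair_pmf p q) f =
    measure_pmf.expectation p (\<lambda>a. measure_pmf.expectation q (\<lambda>b. f (a, b)))"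
proof -
  have int: "integrable (measure_pmf r) g" if "\<And>z. norm (g z) \<le> c" for g :: "'z \<Rightarrow> complex" and r
    using that by (intro integrable_measure_pmf_bounded[of _ _ c]) auto
  have le: "norm (measure_pmf.expectation q (\<lambda>b. f (a, b))) \<le> c" for a
    using bound
    by (intro order.trans[OF integral_norm_bound] measure_pmf.integral_le_const integrable_norm int) auto
  have "Re (measure_pmf.expectation (pair_pmf p q) f) = measure_pmf.expectation (pair_pmf p q) (\<lambda>z. Re (f z))"
    by (rule integral_Re[symmetric]) (rule int[OF bound])
  also have "\<dots> = measure_pmf.expectation p (\<lambda>a. measure_pmf.expectation q (\<lambda>b. Re (f (a, b))))"
    using bound by (intro expectation_pair_pmf_real[of _ c]) (meson abs_Re_le_cmod order.trans)
  also have "\<dots> = Re (measure_pmf.expectation p (\<lambda>a. measure_pmf.expectation q (\<lambda>b. f (a, b))))"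
    by (simp add: int[OF bound] int[OF le])
  finally have re: "Re (measure_pmf.expectation (pair_pmf p q) f) =
    Re (measure_pmf.expectation p (\<lambda>a. measure_pmf.expectation q (\<lambda>b. f (a, b))))" .
  have "Im (measure_pmf.expectation (pair_pmf p q) f) = measure_pmf.expectation (pair_pmf p q) (\<lambda>z. Im (f z))"
    by (rule integral_Im[symmetric]) (rule int[OF bound])
  also have "\<dots> = measure_pmf.expectation p (\<lambda>a. measure_pmf.expectation q (\<lambda>b. Im (f (a, b))))"
    using bound by (intro expectation_pair_pmf_real[of _ c]) (meson abs_Im_le_cmod order.trans)
  also have "\<dots> = Im (measure_pmf.expectation p (\<lambda>a. measure_pmf.expectation q (\<lambda>b. f (a, b))))"
    by (simp add: int[OF bound] int[OF le])
  finally show ?thesis using re by (intro complex_eqI)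
qed

text \<open>For negative \<open>x\<close>, \<open>(1 + x + x^2) * (1 - x) = 1 - x^3\<close> is at
  least 1, and \<open>1 - x\<close> is at most \<open>exp (- x)\<close>.\<close>

lemma exp_le_quadratic:
  fixes x :: real
  assumes "x \<le> 1"
  shows "exp x \<le> 1 + x + x\<^sup>2"
proof (cases "0 \<le> x")
  case True
  then show ?thesis using assms exp_bound by simp
next
  case False
  have "1 \<le> (1 + x + x\<^sup>2) * (1 - x)"
  proof -
    have "x ^ 3 \<le> 0" using False by (simp add: power3_eq_cube mult_nonneg_nonpos mult_nonpos_nonpos)
    then show ?thesis by (simp add: power2_eq_square power3_eq_cube algebra_simps)
  qed
  also have "\<dots> \<le> (1 + x + x\<^sup>2) * exp (- x)"
  proof (intro mult_left_mono)
    have "0 \<le> 3/4 + (x + 1/2)\<^sup>2" by simp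
    then show "0 \<le> 1 + x + x\<^sup>2" by (simp add: power2_eq_square algebra_simps)
    show "1 - x \<le> exp (- x)" using exp_ge_add_one_self[of "- x"] by simp
  qed
  finally show ?thesis by (simp add: exp_minus field_simps)
qed

text \<open>All that the limit argument needs from one system is a single slot in equilibrium:
  \<open>\<rho>\<close> is the joint law of the queue lengths and the chosen queue,
  \<open>\<nu>\<close> the law of the input, and \<open>pair_pmf\<close> makes the input independent
  of both. In \<open>second_moment\<close>, \<open>N * v\<close> is the variance of the net input
  and \<open>(N * \<epsilon>)\<^sup>2\<close> the square of its mean.\<close>

locale stationary_jsq =
  fixes N :: nat and C \<epsilon> v :: real
    and \<rho> :: "((nat \<Rightarrow> nat) \<times> nat) pmf"
    and \<nu> :: "(nat \<Rightarrow> nat) pmf"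
  assumes N_pos: "0 < N" and C_ge_1: "1 \<le> C" and eps_nonneg: "0 \<le> \<epsilon>" and eps_le: "\<epsilon> \<le> 1 / 2"
    and arrivals_le: "\<And>w. w \<in> set_pmf \<nu> \<Longrightarrow> real (w 0) \<le> N * C"
    and services_le: "\<And>w j. w \<in> set_pmf \<nu> \<Longrightarrow> j \<in> {1..N} \<Longrightarrow> real (w j) \<le> C"
    and mean_arrivals: "measure_pmf.expectation \<nu> (\<lambda>w. real (w 0)) = N * (1 - \<epsilon>)"
    and mean_services: "\<And>j. j \<in> {1..N} \<Longrightarrow> measure_pmf.expectation \<nu> (\<lambda>w. real (w j)) = 1"
    and second_moment: "measure_pmf.expectation \<nu> (\<lambda>w. (total_net N w)\<^sup>2) = N * v + (N * \<epsilon>)\<^sup>2"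
    and routing: "\<And>x i. (x, i) \<in> set_pmf \<rho> \<Longrightarrow> i \<in> shortest_queues N x"
    and stationary: "map_pmf (\<lambda>((x, i), w). jsq_step N x i w) (pair_pmf \<rho> \<nu>) = map_pmf fst \<rho>"
begin

text \<open>Arrivals and total service of a slot are each at most \<open>N * C\<close>, so this
  bounds the sum of the absolute net inputs, and with it the change of the spread before
  reflection.\<close>

definition B :: real where "B = 2 * N * C"

text \<open>
  With this exponent the second-order term \<open>\<eta>\<^sup>2 B\<^sup>2\<close> of the exponential cancels half of the drift \<open>- \<eta> / 8\<close>.
\<close>
definition \<eta> :: real where "\<eta> = 1 / (16 * B\<^sup>2)"

lemma B_ge_1: "1 \<le> B"
proof -
  have "1 * 1 \<le> real N * C" using N_pos C_ge_1 by (intro mult_mono) auto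
  then show ?thesis by (simp add: B_def)
qed

lemma eta_pos: "0 < \<eta>" and eta_le: "\<eta> \<le> 1 / 16" and eta_B: "\<eta> * B \<le> 1 / 16"
  and eta_B_square: "\<eta> * B\<^sup>2 = 1 / 16"
proof -
  have "B \<le> B\<^sup>2" using B_ge_1 self_le_power[of B 2] by simp
  moreover then have "1 \<le> B\<^sup>2" using B_ge_1 by linarith
  ultimately show "0 < \<eta>" "\<eta> \<le> 1 / 16" "\<eta> * B \<le> 1 / 16" "\<eta> * B\<^sup>2 = 1 / 16"
    using B_ge_1 by (auto simp: \<eta>_def field_simps)
qed

lemma jobs_le: "w \<in> set_pmf \<nu> \<Longrightarrow> jobs N w \<le> N * C"
  using sum_mono[of "{1..N}" "\<lambda>j. real (w j)" "\<lambda>_. C"] services_le by (simp add: jobs_def)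

lemma jobs_nonneg: "0 \<le> jobs N x"
  by (simp add: jobs_def sum_nonneg)

lemma routing_server: "(x, i) \<in> set_pmf \<rho> \<Longrightarrow> i \<in> {1..N}"
  and routing_min: "(x, i) \<in> set_pmf \<rho> \<Longrightarrow> j \<in> {1..N} \<Longrightarrow> x i \<le> x j"
  using routing[of x i] by (auto simp: shortest_queues_def is_arg_min_linorder)

lemma spread_net_input_le:
  assumes "i \<in> {1..N}" "w \<in> set_pmf \<nu>"
  shows "spread {1..N} (net_input i w) \<le> B"
proof -
  have "spread {1..N} (net_input i w) \<le> (\<Sum>j=1..N. \<bar>net_input i w j\<bar>)"
    using N_pos by (intro spread_le_sum_abs) auto
  also have "\<dots> \<le> real (w 0) + jobs N w" by (rule sum_abs_net_input_le) fact
  also have "\<dots> \<le> B" using arrivals_le[OF assms(2)] jobs_le[OF assms(2)] by (simp add: B_def)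
  finally show ?thesis .
qed

lemma integrable_nu_coordinate [simp]:
  assumes "j \<le> N"
  shows "integrable (measure_pmf \<nu>) (\<lambda>w. real (w j))"
proof (rule integrable_measure_pmf_bounded)
  fix w assume "w \<in> set_pmf \<nu>"
  moreover have "C \<le> N * C" using N_pos C_ge_1 by simp
  ultimately show "norm (real (w j)) \<le> N * C"
    using arrivals_le[of w] services_le[of w j] assms by (cases "j = 0") auto
qed

lemma integrable_net_input:
  assumes "j \<in> {1..N}"
  shows "integrable (measure_pmf \<nu>) (\<lambda>w. net_input i w j)"
  using assms unfolding net_input_def by (cases "j = i") auto

lemma expectation_net_input:
  assumes "j \<in> {1..N}"
  shows "measure_pmf.expectation \<nu> (\<lambda>w. net_input i w j) = (if j = i then N * (1 - \<epsilon>) else 0) - 1"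
  using assms mean_arrivals mean_services[OF assms]
  unfolding net_input_def by (cases "j = i") auto

text \<open>In the mean of the cross term the services cancel, since all have mean 1 and the
  deviations sum to 0. What remains are the arrivals \<open>N * (1 - \<epsilon>)\<close> times the
  deviation of a shortest queue. That deviation is at most \<open>- W / (2 * N)\<close> for the
  spread \<open>W\<close>, and \<open>\<epsilon> \<le> 1 / 2\<close>, so the cross term is at most
  \<open>- W / 4\<close> and enters the square twice.\<close>

lemma spread_square_drift:
  assumes xi: "(x, i) \<in> set_pmf \<rho>"
  shows "measure_pmf.expectation \<nu> (\<lambda>w. (spread {1..N} (\<lambda>j. real (x j) + net_input i w j))\<^sup>2)
    \<le> (spread {1..N} x)\<^sup>2 - spread {1..N} x / 2 + B\<^sup>2" 
proof -
  let ?E = "measure_pmf.expectation \<nu>" and ?W = "spread {1..N} x"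
    and ?Z = "\<lambda>w. spread {1..N} (\<lambda>j. real (x j) + net_input i w j)"
  let ?m = "avg {1..N} x"
  have i: "i \<in> {1..N}" using routing_server[OF xi] .
  have fin: "finite {1..N}" "{1..N} \<noteq> {}" using N_pos by auto
  have int: "integrable (measure_pmf \<nu>) (\<lambda>w. \<Sum>j=1..N. (real (x j) - ?m) * net_input i w j)"
    using integrable_net_input by auto
  have "?E (\<lambda>w. ?Z w ^ 2) \<le> ?E (\<lambda>w. ?W\<^sup>2 + 2 * (\<Sum>j=1..N. (real (x j) - ?m) * net_input i w j) + B\<^sup>2)"
  proof (rule integral_mono_AE)
    show "integrable (measure_pmf \<nu>) (\<lambda>w. (?Z w)\<^sup>2)"
    proof (rule integrable_measure_pmf_bounded)
      fix w assume "w \<in> set_pmf \<nu>"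
      then have "?Z w \<le> ?W + B"
        using spread_triangle[of "{1..N}" x "net_input i w"] spread_net_input_le[OF i] by force
      then show "norm ((?Z w)\<^sup>2) \<le> (?W + B)\<^sup>2"
        by (simp add: power_mono spread_nonneg)
    qed
    show "AE w in \<nu>. (?Z w)\<^sup>2 \<le> ?W\<^sup>2 + 2 * (\<Sum>j=1..N. (real (x j) - ?m) * net_input i w j) + B\<^sup>2"
      using spread_net_input_le[OF i] spread_add_square[OF fin, of x]
      by (auto simp: AE_measure_pmf_iff spread_nonneg power_mono)
  qed (use int in auto)
  also have "\<dots> = ?W\<^sup>2 + 2 * ?E (\<lambda>w. \<Sum>j=1..N. (real (x j) - ?m) * net_input i w j) + B\<^sup>2"
    using int by simp
  also have "?E (\<lambda>w. \<Sum>j=1..N. (real (x j) - ?m) * net_input i w j) =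
      (\<Sum>j=1..N. (real (x j) - ?m) * ((if j = i then N * (1 - \<epsilon>) else 0) - 1))"
    using integrable_net_input by (simp add: expectation_net_input)
  also have "\<dots> = (\<Sum>j=1..N. (if j = i then (real (x j) - ?m) * (N * (1 - \<epsilon>)) else 0)) - (\<Sum>j=1..N. real (x j) - ?m)"
    unfolding sum_subtractf[symmetric] by (intro sum.cong) (auto simp: algebra_simps)
  also have "\<dots> = (real (x i) - ?m) * (N * (1 - \<epsilon>))"
    using sum_diff_avg[OF fin, of x] i by simp
  also have "\<dots> \<le> - (?W / 4)"
  proof -
    have W: "?W \<le> 2 * N * (?m - real (x i))"
      using spread_le_avg_minus_min[OF fin, of "real (x i)" x] routing_min[OF xi] by simp
    then have "0 \<le> 2 * N * (?m - real (x i))" using spread_nonneg[of "{1..N}" x] by linarith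
    then have "2 * N * (?m - real (x i)) * (1 / 2) \<le> 2 * N * (?m - real (x i)) * (1 - \<epsilon>)"
      using eps_le by (intro mult_left_mono) auto
    with W show ?thesis by (simp add: algebra_simps)
  qed
  finally show ?thesis by simp
qed

text \<open>The exponential is expanded to second order. Far out the linear term contributes
  \<open>- \<eta> / 8\<close>, and the quadratic one at most
  \<open>\<eta>\<^sup>2 * B\<^sup>2 = \<eta> / 16\<close>.\<close>

lemma exp_spread_drift_outside:
  assumes xi: "(x, i) \<in> set_pmf \<rho>" and far: "4 * B\<^sup>2 \<le> spread {1..N} x"
  shows "measure_pmf.expectation \<nu> (\<lambda>w. exp (\<eta> * spread {1..N} (\<lambda>j. real (x j) + net_input i w j)))
    \<le> (1 - \<eta> / 16) * exp (\<eta> * spread {1..N} x)" 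
proof -
  let ?E = "measure_pmf.expectation \<nu>" and ?W = "spread {1..N} x"
    and ?Z = "\<lambda>w. spread {1..N} (\<lambda>j. real (x j) + net_input i w j)"
  have i: "i \<in> {1..N}" using routing_server[OF xi] .
  have W: "0 < ?W" using far B_ge_1 by (smt (verit) zero_less_power)
  have diff: "\<bar>?Z w - ?W\<bar> \<le> B" if "w \<in> set_pmf \<nu>" for w
    using abs_spread_diff_le[of "{1..N}" x "net_input i w"] spread_net_input_le[OF i that] by linarith
  then have Z_le: "?Z w \<le> ?W + B" if "w \<in> set_pmf \<nu>" for w using that by fastforce
  have int_Z: "integrable (measure_pmf \<nu>) ?Z"
    using Z_le by (intro integrable_measure_pmf_bounded[of _ _ "?W + B"]) (auto simp: spread_nonneg)
  have int_Z2: "integrable (measure_pmf \<nu>) (\<lambda>w. (?Z w)\<^sup>2)"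
    using Z_le by (intro integrable_measure_pmf_bounded[of _ _ "(?W + B)\<^sup>2"])
      (auto simp: spread_nonneg power_mono)
  have "?E (\<lambda>w. exp (\<eta> * ?Z w)) \<le>
      ?E (\<lambda>w. exp (\<eta> * ?W) * (1 + \<eta> * ((?Z w)\<^sup>2 - ?W\<^sup>2) / (2 * ?W) + \<eta>\<^sup>2 * B\<^sup>2))"
  proof (rule integral_mono_AE)
    show "integrable (measure_pmf \<nu>) (\<lambda>w. exp (\<eta> * ?Z w))"
      using Z_le eta_pos by (intro integrable_measure_pmf_bounded[of _ _ "exp (\<eta> * (?W + B))"]) auto
    have "exp (\<eta> * ?Z w) \<le> exp (\<eta> * ?W) * (1 + \<eta> * ((?Z w)\<^sup>2 - ?W\<^sup>2) / (2 * ?W) + \<eta>\<^sup>2 * B\<^sup>2)"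
      if w: "w \<in> set_pmf \<nu>" for w
    proof -
      have "\<eta> * (?Z w - ?W) \<le> \<eta> * B" using diff[OF w] eta_pos by (intro mult_left_mono) auto
      then have "exp (\<eta> * (?Z w - ?W)) \<le> 1 + \<eta> * (?Z w - ?W) + (\<eta> * (?Z w - ?W))\<^sup>2"
        using eta_B by (intro exp_le_quadratic) linarith
      also have "(\<eta> * (?Z w - ?W))\<^sup>2 \<le> \<eta>\<^sup>2 * B\<^sup>2"
        using diff[OF w] B_ge_1 by (simp add: power_mult_distrib abs_le_square_iff[symmetric] mult_left_mono)
      \<comment> \<open>Concavity of the square root: its tangent at \<open>?W\<^sup>2\<close>
        converts the drift of the squared spread into a drift of the spread.\<close>
      also have "?Z w - ?W \<le> ((?Z w)\<^sup>2 - ?W\<^sup>2) / (2 * ?W)"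
      proof -
        have "2 * ?W * (?Z w - ?W) \<le> (?Z w)\<^sup>2 - ?W\<^sup>2"
          using zero_le_power2[of "?Z w - ?W"] by (simp add: power2_eq_square algebra_simps)
        then show ?thesis using W by (simp add: field_simps)
      qed
      finally have "exp (\<eta> * (?Z w - ?W)) \<le> 1 + \<eta> * ((?Z w)\<^sup>2 - ?W\<^sup>2) / (2 * ?W) + \<eta>\<^sup>2 * B\<^sup>2"
        using eta_pos by (simp add: mult_left_mono)
      then have "exp (\<eta> * ?W) * exp (\<eta> * (?Z w - ?W)) \<le>
          exp (\<eta> * ?W) * (1 + \<eta> * ((?Z w)\<^sup>2 - ?W\<^sup>2) / (2 * ?W) + \<eta>\<^sup>2 * B\<^sup>2)"
        by (intro mult_left_mono) auto
      then show ?thesis by (simp add: exp_add[symmetric] algebra_simps)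
    qed
    then show "AE w in \<nu>. exp (\<eta> * ?Z w) \<le>
        exp (\<eta> * ?W) * (1 + \<eta> * ((?Z w)\<^sup>2 - ?W\<^sup>2) / (2 * ?W) + \<eta>\<^sup>2 * B\<^sup>2)"
      by (simp add: AE_measure_pmf_iff)
  qed (use int_Z2 in auto)
  also have "\<dots> = exp (\<eta> * ?W) * (1 + \<eta> * ((?E (\<lambda>w. (?Z w)\<^sup>2) - ?W\<^sup>2) / (2 * ?W)) + \<eta>\<^sup>2 * B\<^sup>2)"
    using int_Z2 by simp
  also have "\<dots> \<le> exp (\<eta> * ?W) * (1 + \<eta> * (- (1 / 8)) + \<eta> * (1 / 16))"
  proof (intro mult_left_mono add_mono order.refl)
    have "?E (\<lambda>w. (?Z w)\<^sup>2) - ?W\<^sup>2 \<le> - ?W / 2 + B\<^sup>2"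
      using spread_square_drift[OF xi] by simp
    \<comment> \<open>The radius \<open>4 * B\<^sup>2\<close> is chosen so that
      \<open>B\<^sup>2\<close> uses up at most half of the drift \<open>?W / 2\<close>.\<close>
    also have "\<dots> \<le> - ?W / 4" using far by simp
    finally show "(?E (\<lambda>w. (?Z w)\<^sup>2) - ?W\<^sup>2) / (2 * ?W) \<le> - (1 / 8)"
      using W by (simp add: field_simps)
    show "\<eta>\<^sup>2 * B\<^sup>2 \<le> \<eta> * (1 / 16)"
      using eta_B_square by (simp add: power2_eq_square mult.assoc)
  qed (use eta_pos in auto)
  finally show ?thesis by (simp add: algebra_simps)
qed

text \<open>The added 2 covers the inside of the ball: there the exponent after one slot is at most
  \<open>4 * \<eta> * B\<^sup>2 + \<eta> * B \<le> 1 / 2\<close>, and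
  \<open>exp (1 / 2) \<le> 2\<close>.\<close>

lemma exp_spread_drift:
  assumes xi: "(x, i) \<in> set_pmf \<rho>"
  shows "measure_pmf.expectation \<nu> (\<lambda>w. exp (\<eta> * spread {1..N} (\<lambda>j. real (x j) + net_input i w j)))
    \<le> (1 - \<eta> / 16) * exp (\<eta> * spread {1..N} x) + 2"
proof (cases "4 * B\<^sup>2 \<le> spread {1..N} x")
  case True
  from exp_spread_drift_outside[OF xi this] show ?thesis by simp
next
  case False
  let ?Z = "\<lambda>w. spread {1..N} (\<lambda>j. real (x j) + net_input i w j)"
  have "exp (\<eta> * ?Z w) \<le> 2" if "w \<in> set_pmf \<nu>" for w
  proof -
    have "?Z w \<le> 4 * B\<^sup>2 + B"
      using False abs_spread_diff_le[of "{1..N}" x "net_input i w"]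
        spread_net_input_le[OF routing_server[OF xi] that] by linarith
    then have "\<eta> * ?Z w \<le> \<eta> * (4 * B\<^sup>2 + B)" using eta_pos by (intro mult_left_mono) auto
    also have "\<dots> = 4 * (\<eta> * B\<^sup>2) + \<eta> * B" by (simp add: algebra_simps)
    also have "\<dots> \<le> 1 / 2" using eta_B eta_B_square by linarith
    finally have "exp (\<eta> * ?Z w) \<le> exp (1 / 2)" by simp
    also have "\<dots> \<le> (2::real)" using exp_le_quadratic[of "1 / 2"] by (simp add: power2_eq_square)
    finally show ?thesis .
  qed
  then have "measure_pmf.expectation \<nu> (\<lambda>w. exp (\<eta> * ?Z w)) \<le> 2"
    by (intro measure_pmf.integral_le_const integrable_measure_pmf_bounded[of _ _ 2])
      (auto simp: AE_measure_pmf_iff)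
  moreover have "0 \<le> (1 - \<eta> / 16) * exp (\<eta> * spread {1..N} x)" using eta_le by simp
  ultimately show ?thesis by linarith
qed

lemma expectation_next:
  fixes f :: "(nat \<Rightarrow> nat) \<Rightarrow> 'b::{banach, second_countable_topology}"
  shows "measure_pmf.expectation (pair_pmf \<rho> \<nu>) (\<lambda>((x, i), w). f (jsq_step N x i w)) =
    measure_pmf.expectation \<rho> (\<lambda>(x, i). f x)"
  using arg_cong[OF stationary, of "\<lambda>p. measure_pmf.expectation p f"]
  by (simp add: case_prod_unfold)

end

section \<open>Tail of the spread and mean unused service in steady state\<close>

context stationary_jsq
begin

text \<open>Stationarity is applied to a bounded function of the state. Given the current state, the
  mean of the truncated exponential after the slot is at most \<open>n\<close> and at most the drift
  bound, hence at most their minimum.\<close>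

lemma truncated_exp_spread_le:
  "measure_pmf.expectation \<rho> (\<lambda>(x, i). min (real n) (exp (\<eta> * spread {1..N} (\<lambda>j. real (x j)))))
    \<le> measure_pmf.expectation \<rho> (\<lambda>(x, i). min (real n) ((1 - \<eta> / 16) * exp (\<eta> * spread {1..N} (\<lambda>j. real (x j))) + 2))"
proof -
  let ?V = "\<lambda>x::nat \<Rightarrow> nat. exp (\<eta> * spread {1..N} x)"
  have "measure_pmf.expectation \<rho> (\<lambda>(x, i). min (real n) (?V x)) =
      measure_pmf.expectation (pair_pmf \<rho> \<nu>) (\<lambda>((x, i), w). min (real n) (?V (jsq_step N x i w)))"
    by (rule expectation_next[symmetric])
  also have "\<dots> = measure_pmf.expectation \<rho> (\<lambda>(x, i). measure_pmf.expectation \<nu>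
      (\<lambda>w. min (real n) (?V (jsq_step N x i w))))"
    by (subst expectation_pair_pmf_nonneg[of _ _ _ n]) (auto simp: case_prod_unfold)
  also have "\<dots> \<le> measure_pmf.expectation \<rho> (\<lambda>(x, i). min (real n) ((1 - \<eta> / 16) * ?V x + 2))"
  proof (rule integral_mono_AE)
    have int: "integrable (measure_pmf \<nu>) (\<lambda>w. min (real n) (?V (jsq_step N x i w)))" for x i
      by (intro integrable_measure_pmf_bounded[of _ _ n]) auto
    have bounds: "measure_pmf.expectation \<nu> (\<lambda>w. min (real n) (?V (jsq_step N x i w))) \<le> n"
      "0 \<le> measure_pmf.expectation \<nu> (\<lambda>w. min (real n) (?V (jsq_step N x i w)))" for x i
      by (rule measure_pmf.integral_le_const[OF int], simp) (simp add: integral_nonneg_AE)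
    then show "integrable (measure_pmf \<rho>) (\<lambda>(x, i). measure_pmf.expectation \<nu>
        (\<lambda>w. min (real n) (?V (jsq_step N x i w))))"
      by (intro integrable_measure_pmf_bounded[of _ _ n]) (auto simp: case_prod_unfold)
    show "integrable (measure_pmf \<rho>) (\<lambda>(x, i). min (real n) ((1 - \<eta> / 16) * ?V x + 2))"
      using eta_le by (intro integrable_measure_pmf_bounded[of _ _ n]) (auto simp: case_prod_unfold)
    have "measure_pmf.expectation \<nu> (\<lambda>w. min (real n) (?V (jsq_step N x i w)))
        \<le> (1 - \<eta> / 16) * ?V x + 2" if xi: "(x, i) \<in> set_pmf \<rho>" for x i
    proof -
      have "measure_pmf.expectation \<nu> (\<lambda>w. min (real n) (?V (jsq_step N x i w)))
          \<le> measure_pmf.expectation \<nu> (\<lambda>w. exp (\<eta> * spread {1..N} (\<lambda>j. real (x j) + net_input i w j)))"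
      proof (rule integral_mono_AE[OF int])
        have "spread {1..N} (\<lambda>j. real (x j) + net_input i w j) \<le> spread {1..N} x + B"
          if "w \<in> set_pmf \<nu>" for w
          using spread_triangle[of "{1..N}" x "net_input i w"]
            spread_net_input_le[OF routing_server[OF xi] that] by linarith
        then show "integrable (measure_pmf \<nu>)
            (\<lambda>w. exp (\<eta> * spread {1..N} (\<lambda>j. real (x j) + net_input i w j)))"
          using eta_pos
          by (intro integrable_measure_pmf_bounded[of _ _ "exp (\<eta> * (spread {1..N} x + B))"]) auto
        show "AE w in \<nu>. min (real n) (?V (jsq_step N x i w)) \<le>
            exp (\<eta> * spread {1..N} (\<lambda>j. real (x j) + net_input i w j))"
          using spread_jsq_step[OF N_pos] eta_pos by (auto intro!: min.coboundedI2)
      qed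
      also have "\<dots> \<le> (1 - \<eta> / 16) * ?V x + 2" by (rule exp_spread_drift[OF xi])
      finally show ?thesis .
    qed
    with bounds show "AE z in \<rho>. (case z of (x, i) \<Rightarrow> measure_pmf.expectation \<nu>
          (\<lambda>w. min (real n) (?V (jsq_step N x i w))))
        \<le> (case z of (x, i) \<Rightarrow> min (real n) ((1 - \<eta> / 16) * ?V x + 2))"
      by (auto simp: AE_measure_pmf_iff)
  qed
  finally show ?thesis .
qed

text \<open>
  The truncation at \<open>n\<close> replaces integrability of the exponential under the stationary distribution,
  which is not known in advance.
\<close>
lemma prob_spread_ge:
  "measure_pmf.prob \<rho> {z. R \<le> spread {1..N} (\<lambda>j. real (fst z j))} \<le> 32 / (\<eta> * exp (\<eta> * R))"
proof -
  let ?V = "\<lambda>z::(nat \<Rightarrow> nat) \<times> nat. exp (\<eta> * spread {1..N} (\<lambda>j. real (fst z j)))"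
  let ?A = "\<lambda>n::nat. {z. R \<le> spread {1..N} (\<lambda>j. real (fst z j)) \<and> ?V z \<le> n}"
  have bound: "measure_pmf.prob \<rho> (?A n) \<le> 32 / (\<eta> * exp (\<eta> * R))" for n
  proof -
    let ?f = "\<lambda>z. min (real n) (?V z)" and ?g = "\<lambda>z. min (real n) ((1 - \<eta> / 16) * ?V z + 2)"
    have int: "integrable (measure_pmf \<rho>) ?f" "integrable (measure_pmf \<rho>) ?g"
      using eta_le by (auto intro!: integrable_measure_pmf_bounded[of _ _ n])
    have "\<eta> / 16 * exp (\<eta> * R) * measure_pmf.prob \<rho> (?A n) =
        measure_pmf.expectation \<rho> (\<lambda>z. \<eta> / 16 * exp (\<eta> * R) * indicator (?A n) z)"
      by simp
    \<comment> \<open>On \<open>?A n\<close> the truncation leaves \<open>?V\<close> unchanged, so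
      \<open>?f - ?g + 2\<close> is at least \<open>\<eta> / 16 * ?V\<close>; elsewhere it is still
      nonnegative.\<close>
    also have "\<dots> \<le> measure_pmf.expectation \<rho> (\<lambda>z. ?f z - ?g z + 2)"
    proof (rule integral_mono)
      fix z
      show "\<eta> / 16 * exp (\<eta> * R) * indicator (?A n) z \<le> ?f z - ?g z + 2"
      proof (cases "z \<in> ?A n")
        case True
        then have "exp (\<eta> * R) \<le> ?V z" using eta_pos by simp
        then have "\<eta> / 16 * exp (\<eta> * R) \<le> \<eta> / 16 * ?V z" using eta_pos by (intro mult_left_mono) auto
        also have "\<dots> \<le> ?f z - ?g z + 2" using True by (simp add: algebra_simps)
        finally show ?thesis using True by simp
      next
        case False
        have "(1 - \<eta> / 16) * ?V z \<le> ?V z" using eta_pos by simp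
        then have "?g z \<le> ?f z + 2" by linarith
        then show ?thesis using False by simp
      qed
      show "integrable (measure_pmf \<rho>) (\<lambda>z. \<eta> / 16 * exp (\<eta> * R) * indicator (?A n) z)"
        using eta_pos
        by (intro integrable_measure_pmf_bounded[of _ _ "\<eta> / 16 * exp (\<eta> * R)"]) (simp add: indicator_def)
    qed (use int in auto)
    \<comment> \<open>The mean of \<open>?f\<close> is at most that of \<open>?g\<close> by the
      previous lemma. Dividing 2 by \<open>\<eta> / 16\<close> gives the factor 32 of the
      claim.\<close>
    also have "\<dots> \<le> 2"
      using int truncated_exp_spread_le[of n] by (simp add: case_prod_unfold)
    finally show ?thesis using eta_pos by (simp add: field_simps)
  qed
  \<comment> \<open>The bound is uniform in \<open>n\<close>, and the sets \<open>?A n\<close>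
    increase to the full tail event.\<close>
  have "(\<lambda>n. measure_pmf.prob \<rho> (?A n)) \<longlonglongrightarrow> measure_pmf.prob \<rho> (\<Union>n. ?A n)"
    by (intro measure_pmf.finite_Lim_measure_incseq) (auto simp: incseq_def)
  also have "(\<Union>n. ?A n) = {z. R \<le> spread {1..N} (\<lambda>j. real (fst z j))}"
    using real_arch_simple by blast
  finally show ?thesis
    using bound by (intro LIMSEQ_le_const2) auto
qed

lemma abs_total_net_le:
  assumes "w \<in> set_pmf \<nu>"
  shows "\<bar>total_net N w\<bar> \<le> N * C"
  using arrivals_le[OF assms] jobs_le[OF assms] jobs_nonneg[of w] by (simp add: total_net_def)

lemma integrable_total_net: "integrable (measure_pmf \<nu>) (total_net N)"
  using abs_total_net_le by (intro integrable_measure_pmf_bounded[of _ _ "real N * C"]) auto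

lemma expectation_total_net: "measure_pmf.expectation \<nu> (total_net N) = - (N * \<epsilon>)"
proof -
  have "measure_pmf.expectation \<nu> (total_net N) =
      measure_pmf.expectation \<nu> (\<lambda>w. real (w 0) - (\<Sum>j=1..N. real (w j)))"
    by (simp add: total_net_def[abs_def] jobs_def)
  also have "\<dots> = N * (1 - \<epsilon>) - (\<Sum>j=1..N. 1)"
    by (subst Bochner_Integration.integral_diff) (auto simp: mean_arrivals mean_services)
  finally show ?thesis by (simp add: algebra_simps)
qed

abbreviation unused' :: "((nat \<Rightarrow> nat) \<times> nat) \<times> (nat \<Rightarrow> nat) \<Rightarrow> real" where
  "unused' \<equiv> \<lambda>((x, i), w). unused N x i w"

lemma unused_le:
  assumes "z \<in> set_pmf (pair_pmf \<rho> \<nu>)"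
  shows "unused' z \<le> N * C"
proof -
  obtain x i w where z: "z = ((x, i), w)" by (metis prod.exhaust)
  then show ?thesis
    using assms unused_le_jobs[of N x i w] jobs_le[of w] by auto
qed

lemma integrable_unused: "integrable (measure_pmf (pair_pmf \<rho> \<nu>)) unused'"
proof (rule integrable_measure_pmf_bounded)
  fix z assume "z \<in> set_pmf (pair_pmf \<rho> \<nu>)"
  from unused_le[OF this] show "norm (unused' z) \<le> N * C"
    by (simp add: case_prod_unfold unused_nonneg)
qed

text \<open>
  The stationary queue lengths might a priori have infinite mean; dominated convergence along the
  truncations at \<open>n\<close> only needs that their increments are bounded.
\<close>
lemma expectation_unused: "measure_pmf.expectation (pair_pmf \<rho> \<nu>) unused' = N * \<epsilon>"
proof -
  let ?J = "pair_pmf \<rho> \<nu>"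
  let ?Q = "\<lambda>((x, i), w). jobs N x" and ?Q' = "\<lambda>((x, i), w). jobs N (jsq_step N x i w)"
  let ?T = "\<lambda>z. total_net N (snd z)"
  have step: "?Q' z = ?Q z + (?T z + unused' z)" if "z \<in> set_pmf ?J" for z
    using that jobs_jsq_step[OF routing_server] by (auto simp: case_prod_unfold)
  have bound: "\<bar>?T z + unused' z\<bar> \<le> 2 * (real N * C)" if "z \<in> set_pmf ?J" for z
    using that unused_le[OF that] abs_total_net_le[of "snd z"] unused_nonneg[of N "fst (fst z)" "snd (fst z)" "snd z"]
    by (auto simp: case_prod_unfold)
  have zero: "measure_pmf.expectation ?J (\<lambda>z. min (real n) (?Q' z) - min (real n) (?Q z)) = 0" for n
  proof -
    have "measure_pmf.expectation ?J (\<lambda>z. min (real n) (?Q z)) =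
        measure_pmf.expectation ?J (\<lambda>z. (\<lambda>(x, i). min (real n) (jobs N x)) (fst z))"
      by (simp add: case_prod_unfold)
    also have "\<dots> = measure_pmf.expectation \<rho> (\<lambda>(x, i). min (real n) (jobs N x))"
      by (rule expectation_pair_pmf_fst)
    also have "\<dots> = measure_pmf.expectation ?J (\<lambda>((x, i), w). min (real n) (jobs N (jsq_step N x i w)))"
      by (rule expectation_next[symmetric])
    finally show ?thesis
      by (subst Bochner_Integration.integral_diff)
        (auto intro!: integrable_measure_pmf_bounded[of _ _ n] simp: case_prod_unfold jobs_nonneg)
  qed
  have "(\<lambda>n. measure_pmf.expectation ?J (\<lambda>z. min (real n) (?Q' z) - min (real n) (?Q z)))
      \<longlonglongrightarrow> measure_pmf.expectation ?J (\<lambda>z. ?T z + unused' z)"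
  proof (rule integral_dominated_convergence)
    have "(\<lambda>n. min (real n) (?Q' z) - min (real n) (?Q z)) \<longlonglongrightarrow> ?T z + unused' z"
      if "z \<in> set_pmf ?J" for z
    proof (rule tendsto_eventually)
      obtain n0 :: nat where "max (?Q' z) (?Q z) \<le> n0" using real_arch_simple by blast
      then have "\<forall>n\<ge>n0. min (real n) (?Q' z) - min (real n) (?Q z) = ?T z + unused' z"
        using step[OF that] by auto
      then show "\<forall>\<^sub>F n in sequentially. min (real n) (?Q' z) - min (real n) (?Q z) = ?T z + unused' z"
        by (auto simp: eventually_sequentially)
    qed
    then show "AE z in ?J. (\<lambda>n. min (real n) (?Q' z) - min (real n) (?Q z)) \<longlonglongrightarrow> ?T z + unused' z"
      by (simp only: AE_measure_pmf_iff) blast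
    \<comment> \<open>Truncation is 1-Lipschitz, so the bound on the increment of the total queue
      length is a dominating constant.\<close>
    have "norm (min (real n) (?Q' z) - min (real n) (?Q z)) \<le> 2 * (real N * C)" if "z \<in> set_pmf ?J" for n z
      using step[OF that] bound[OF that] by (auto simp: min_def)
    then show "AE z in ?J. norm (min (real n) (?Q' z) - min (real n) (?Q z)) \<le> 2 * (real N * C)" for n
      by (simp only: AE_measure_pmf_iff) blast
  qed auto
  then have "measure_pmf.expectation ?J (\<lambda>z. ?T z + unused' z) = 0"
    unfolding zero by (simp add: LIMSEQ_const_iff)
  moreover have "integrable (measure_pmf ?J) ?T"
    using abs_total_net_le by (intro integrable_measure_pmf_bounded[of _ _ "real N * C"]) auto
  moreover have "measure_pmf.expectation ?J ?T = - (N * \<epsilon>)"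
    using expectation_pair_pmf_snd[of \<rho> \<nu> "total_net N"] expectation_total_net by simp
  ultimately show ?thesis using integrable_unused by simp
qed

end

section \<open>Characteristic function of the total queue length\<close>

lemma norm_iexp_diff_1_le: "cmod (iexp x - 1) \<le> \<bar>x\<bar>" "cmod (iexp x - 1) \<le> 2"
proof -
  show "cmod (iexp x - 1) \<le> \<bar>x\<bar>" using iexp_approx1[of x 0] by simp
  have "cmod (iexp x - 1) \<le> cmod (iexp x) + cmod 1" by (rule norm_triangle_ineq4)
  then show "cmod (iexp x - 1) \<le> 2" by simp
qed

lemma norm_iexp_first_order: "cmod (iexp x - 1 - \<i> * x) \<le> x\<^sup>2 / 2"
  using iexp_approx1[of x 1] by (simp add: numeral_2_eq_2 algebra_simps)

lemma norm_iexp_second_order: "cmod (iexp x - 1 - \<i> * x + x\<^sup>2 / 2) \<le> \<bar>x\<bar> ^ 3 / 6"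
  using iexp_approx1[of x 2] by (simp add: numeral_2_eq_2 numeral_3_eq_3 power2_eq_square algebra_simps)

context stationary_jsq
begin

definition jobs_char :: "real \<Rightarrow> complex" where
  "jobs_char \<theta> = measure_pmf.expectation \<rho> (\<lambda>(x, i). iexp (\<theta> * jobs N x))"

lemma norm_jobs_char_le: "cmod (jobs_char \<theta>) \<le> 1"
proof -
  have "cmod (jobs_char \<theta>) \<le> measure_pmf.expectation \<rho> (\<lambda>z. cmod ((\<lambda>(x, i). iexp (\<theta> * jobs N x)) z))"
    unfolding jobs_char_def by (rule integral_norm_bound)
  then show ?thesis by (simp add: case_prod_unfold)
qed

text \<open>Taylor expansion with third-order remainder, where \<open>total_net\<close> is bounded
  by \<open>N * C\<close>. Its mean is \<open>- (N * \<epsilon>)\<close>, which makes the linear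
  correction appear with a plus sign.\<close>

lemma net_char_expansion:
  fixes \<theta> :: real
  shows "cmod (measure_pmf.expectation \<nu> (\<lambda>w. iexp (\<theta> * total_net N w)) - 1
      + \<i> * \<theta> * (N * \<epsilon>) + \<theta>\<^sup>2 / 2 * (N * v + (N * \<epsilon>)\<^sup>2)) \<le> \<bar>\<theta>\<bar> ^ 3 * (real N * C) ^ 3 / 6"
proof -
  let ?T = "total_net N"
  have int1: "integrable (measure_pmf \<nu>) (\<lambda>w. iexp (\<theta> * ?T w))"
    by (intro integrable_measure_pmf_bounded[of _ _ 1]) simp
  have int2: "integrable (measure_pmf \<nu>) (\<lambda>w. complex_of_real (?T w))"
    using integrable_total_net by simp
  have "integrable (measure_pmf \<nu>) (\<lambda>w. (?T w)\<^sup>2)"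
    using abs_total_net_le
    by (intro integrable_measure_pmf_bounded[of _ _ "(real N * C)\<^sup>2"])
      (simp add: power2_le_iff_abs_le C_ge_1[THEN order_trans[OF zero_le_one]])
  then have int3: "integrable (measure_pmf \<nu>) (\<lambda>w. complex_of_real ((?T w)\<^sup>2))" by (rule integrable_of_real)
  have E2: "measure_pmf.expectation \<nu> (\<lambda>w. complex_of_real ((?T w)\<^sup>2)) = of_real (N * v + (N * \<epsilon>)\<^sup>2)"
    by (subst integral_complex_of_real) (simp only: second_moment)
  have E1: "measure_pmf.expectation \<nu> (\<lambda>w. complex_of_real (?T w)) = of_real (- (N * \<epsilon>))"
    by (subst integral_complex_of_real) (simp only: expectation_total_net)
  have eq: "measure_pmf.expectation \<nu> (\<lambda>w. iexp (\<theta> * ?T w)) - 1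
      + \<i> * \<theta> * (N * \<epsilon>) + \<theta>\<^sup>2 / 2 * (N * v + (N * \<epsilon>)\<^sup>2) =
    measure_pmf.expectation \<nu> (\<lambda>w. iexp (\<theta> * ?T w) - 1 - \<i> * \<theta> * complex_of_real (?T w)
      + complex_of_real (\<theta>\<^sup>2 / 2) * complex_of_real ((?T w)\<^sup>2))"
    using int1 int2 int3 E1 E2 by (simp del: of_real_power)
  have "cmod (measure_pmf.expectation \<nu> (\<lambda>w. iexp (\<theta> * ?T w) - 1 - \<i> * \<theta> * complex_of_real (?T w)
      + complex_of_real (\<theta>\<^sup>2 / 2) * complex_of_real ((?T w)\<^sup>2)))
    \<le> measure_pmf.expectation \<nu> (\<lambda>w. cmod (iexp (\<theta> * ?T w) - 1 - \<i> * \<theta> * complex_of_real (?T w)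
      + complex_of_real (\<theta>\<^sup>2 / 2) * complex_of_real ((?T w)\<^sup>2)))"
    by (rule integral_norm_bound)
  also have "\<dots> \<le> \<bar>\<theta>\<bar> ^ 3 * (real N * C) ^ 3 / 6"
  proof (rule measure_pmf.integral_le_const)
    show "integrable (measure_pmf \<nu>) (\<lambda>w. cmod (iexp (\<theta> * ?T w) - 1 - \<i> * \<theta> * complex_of_real (?T w)
        + complex_of_real (\<theta>\<^sup>2 / 2) * complex_of_real ((?T w)\<^sup>2)))"
      using int1 int2 int3 by (intro integrable_norm) (simp del: of_real_power)
    have "cmod (iexp (\<theta> * ?T w) - 1 - \<i> * \<theta> * complex_of_real (?T w)
        + complex_of_real (\<theta>\<^sup>2 / 2) * complex_of_real ((?T w)\<^sup>2)) \<le> \<bar>\<theta>\<bar> ^ 3 * (real N * C) ^ 3 / 6"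
      if w: "w \<in> set_pmf \<nu>" for w
    proof -
      have "cmod (iexp (\<theta> * ?T w) - 1 - \<i> * \<theta> * complex_of_real (?T w)
          + complex_of_real (\<theta>\<^sup>2 / 2) * complex_of_real ((?T w)\<^sup>2)) \<le> \<bar>\<theta> * ?T w\<bar> ^ 3 / 6"
        using norm_iexp_second_order[of "\<theta> * ?T w"] by (simp add: power_mult_distrib algebra_simps)
      also have "\<dots> = \<bar>\<theta>\<bar> ^ 3 * \<bar>?T w\<bar> ^ 3 / 6" by (simp add: abs_mult power_mult_distrib)
      also have "\<dots> \<le> \<bar>\<theta>\<bar> ^ 3 * (real N * C) ^ 3 / 6"
        using abs_total_net_le[OF w] by (intro divide_right_mono mult_left_mono power_mono) auto
      finally show ?thesis .
    qed
    then show "AE w in \<nu>. cmod (iexp (\<theta> * ?T w) - 1 - \<i> * \<theta> * complex_of_real (?T w)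
        + complex_of_real (\<theta>\<^sup>2 / 2) * complex_of_real ((?T w)\<^sup>2)) \<le> \<bar>\<theta>\<bar> ^ 3 * (real N * C) ^ 3 / 6"
      by (simp only: AE_measure_pmf_iff) blast
  qed
  finally show ?thesis unfolding eq .
qed

lemma unused_char_expansion:
  fixes \<theta> :: real
  shows "cmod (measure_pmf.expectation (pair_pmf \<rho> \<nu>) (\<lambda>z. iexp (- \<theta> * unused' z) - 1) + \<i> * \<theta> * (N * \<epsilon>))
    \<le> \<theta>\<^sup>2 * (real N * C) * (N * \<epsilon>) / 2"
proof -
  let ?J = "pair_pmf \<rho> \<nu>"
  have int1: "integrable (measure_pmf ?J) (\<lambda>z. iexp (- \<theta> * unused' z))"
    by (intro integrable_measure_pmf_bounded[of _ _ 1]) simp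
  have int2: "integrable (measure_pmf ?J) (\<lambda>z. complex_of_real (unused' z))"
    using integrable_unused by (rule integrable_of_real)
  have E: "measure_pmf.expectation ?J (\<lambda>z. complex_of_real (unused' z)) = of_real (N * \<epsilon>)"
    by (subst integral_complex_of_real) (simp only: expectation_unused)
  have "measure_pmf.expectation ?J (\<lambda>z. iexp (- \<theta> * unused' z) - 1) + \<i> * \<theta> * (N * \<epsilon>) =
      measure_pmf.expectation ?J (\<lambda>z. iexp (- \<theta> * unused' z) - 1)
      + \<i> * \<theta> * measure_pmf.expectation ?J (\<lambda>z. complex_of_real (unused' z))"
    using E by simp
  also have "\<dots> = measure_pmf.expectation ?J
      (\<lambda>z. (iexp (- \<theta> * unused' z) - 1) + \<i> * \<theta> * complex_of_real (unused' z))"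
    by (subst Bochner_Integration.integral_add) (intro Bochner_Integration.integrable_diff int1 int2
        integrable_mult_right measure_pmf.integrable_const integral_mult_right_zero[symmetric] | simp)+
  also have "cmod \<dots> \<le> measure_pmf.expectation ?J
      (\<lambda>z. cmod ((iexp (- \<theta> * unused' z) - 1) + \<i> * \<theta> * complex_of_real (unused' z)))"
    by (rule integral_norm_bound)
  also have "\<dots> \<le> measure_pmf.expectation ?J (\<lambda>z. \<theta>\<^sup>2 * (real N * C) / 2 * unused' z)"
  proof (rule integral_mono_AE)
    show "integrable (measure_pmf ?J) (\<lambda>z. cmod ((iexp (- \<theta> * unused' z) - 1) + \<i> * \<theta> * complex_of_real (unused' z)))"
      by (intro integrable_norm Bochner_Integration.integrable_add Bochner_Integration.integrable_diff
          int1 int2 integrable_mult_right measure_pmf.integrable_const)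
    show "integrable (measure_pmf ?J) (\<lambda>z. \<theta>\<^sup>2 * (real N * C) / 2 * unused' z)"
      using integrable_unused by (rule integrable_mult_right)
    have "cmod ((iexp (- \<theta> * unused' z) - 1) + \<i> * \<theta> * complex_of_real (unused' z))
        \<le> \<theta>\<^sup>2 * (real N * C) / 2 * unused' z" if z: "z \<in> set_pmf ?J" for z
    proof -
      have nonneg: "0 \<le> unused' z" by (simp add: case_prod_unfold unused_nonneg)
      have "cmod ((iexp (- \<theta> * unused' z) - 1) + \<i> * \<theta> * complex_of_real (unused' z))
          \<le> (\<theta> * unused' z)\<^sup>2 / 2"
        using norm_iexp_first_order[of "- \<theta> * unused' z"] by (simp add: algebra_simps)
      also have "\<dots> = \<theta>\<^sup>2 / 2 * (unused' z * unused' z)" by (simp add: power2_eq_square)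
      also have "\<dots> \<le> \<theta>\<^sup>2 / 2 * ((real N * C) * unused' z)"
        using unused_le[OF z] nonneg by (intro mult_left_mono mult_right_mono) auto
      finally show ?thesis by (simp add: mult_ac)
    qed
    then show "AE z in ?J. cmod ((iexp (- \<theta> * unused' z) - 1) + \<i> * \<theta> * complex_of_real (unused' z))
        \<le> \<theta>\<^sup>2 * (real N * C) / 2 * unused' z"
      by (simp only: AE_measure_pmf_iff) blast
  qed
  also have "\<dots> = \<theta>\<^sup>2 * (real N * C) / 2 * measure_pmf.expectation ?J unused'"
    by (rule integral_mult_right_zero)
  finally show ?thesis unfolding expectation_unused by (simp add: algebra_simps)
qed

text \<open>
  If some service is unused, then some queue is empty after the step, so that the total queue length is
  at most \<open>N\<close> times the spread, which is rarely above \<open>R\<close>.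
\<close>
lemma cross_term_le:
  fixes \<theta> R :: real
  assumes "0 \<le> R"
  shows "cmod (measure_pmf.expectation (pair_pmf \<rho> \<nu>)
      (\<lambda>z. (iexp (\<theta> * (case z of ((x, i), w) \<Rightarrow> jobs N (jsq_step N x i w))) - 1) * (iexp (- \<theta> * unused' z) - 1)))
    \<le> \<theta>\<^sup>2 * (real N * R) * (N * \<epsilon>) + 2 * \<bar>\<theta>\<bar> * (real N * C) * (32 / (\<eta> * exp (\<eta> * R)))"
proof -
  let ?J = "pair_pmf \<rho> \<nu>"
  let ?Q' = "\<lambda>z. case z of ((x, i), w) \<Rightarrow> jobs N (jsq_step N x i w)"
  let ?W' = "\<lambda>z. case z of ((x, i), w) \<Rightarrow> spread {1..N} (\<lambda>j. real (jsq_step N x i w j))"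
  let ?F = "\<lambda>z. (iexp (\<theta> * ?Q' z) - 1) * (iexp (- \<theta> * unused' z) - 1)"
  let ?A = "{z. R \<le> ?W' z}"
  have "cmod (measure_pmf.expectation ?J ?F) \<le> measure_pmf.expectation ?J (\<lambda>z. cmod (?F z))"
    by (rule integral_norm_bound)
  also have "\<dots> \<le> measure_pmf.expectation ?J
      (\<lambda>z. \<theta>\<^sup>2 * (real N * R) * unused' z + 2 * \<bar>\<theta>\<bar> * (real N * C) * indicator ?A z)"
  proof (rule integral_mono_AE)
    have "cmod (?F z) \<le> 2 * 2" for z
      unfolding norm_mult by (intro mult_mono norm_iexp_diff_1_le(2)) auto
    then show "integrable (measure_pmf ?J) (\<lambda>z. cmod (?F z))"
      by (intro integrable_norm integrable_measure_pmf_bounded[of _ _ "2 * 2"])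
    show "integrable (measure_pmf ?J)
        (\<lambda>z. \<theta>\<^sup>2 * (real N * R) * unused' z + 2 * \<bar>\<theta>\<bar> * (real N * C) * indicator ?A z)"
      by (intro Bochner_Integration.integrable_add integrable_mult_right integrable_unused
          integrable_measure_pmf_bounded[of _ _ 1]) (simp add: indicator_def)
    have "cmod (?F z) \<le> \<theta>\<^sup>2 * (real N * R) * unused' z + 2 * \<bar>\<theta>\<bar> * (real N * C) * indicator ?A z"
      if z: "z \<in> set_pmf ?J" for z
    proof (cases "0 < unused' z")
      case False
      moreover have "0 \<le> unused' z" by (simp add: case_prod_unfold unused_nonneg)
      ultimately have "unused' z = 0" by linarith
      then show ?thesis using C_ge_1 by simp
    next
      case True
      have U: "cmod (iexp (- \<theta> * unused' z) - 1) \<le> \<bar>\<theta>\<bar> * unused' z"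
        using norm_iexp_diff_1_le(1)[of "- \<theta> * unused' z"] True by (simp add: abs_mult)
      have Q0: "0 \<le> ?Q' z" by (simp add: case_prod_unfold jobs_nonneg)
      show ?thesis
      proof (cases "z \<in> ?A")
        case A: True
        have "cmod (?F z) \<le> 2 * (\<bar>\<theta>\<bar> * unused' z)"
          unfolding norm_mult by (intro mult_mono norm_iexp_diff_1_le(2) U) auto
        also have "\<dots> \<le> 2 * (\<bar>\<theta>\<bar> * (real N * C))"
          using unused_le[OF z] by (intro mult_left_mono) auto
        also have "\<dots> \<le> \<theta>\<^sup>2 * (real N * R) * unused' z + 2 * \<bar>\<theta>\<bar> * (real N * C) * indicator ?A z"
          using A True assms by simp
        finally show ?thesis .
      next
        case A: False
        have "?Q' z \<le> N * ?W' z"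
          using jobs_le_spread_if_unused_pos True by (cases z; cases "fst z") auto
        also have "\<dots> \<le> N * R" using A by (intro mult_left_mono) auto
        finally have "\<bar>\<theta>\<bar> * ?Q' z \<le> \<bar>\<theta>\<bar> * (real N * R)" by (intro mult_left_mono) auto
        moreover have "cmod (iexp (\<theta> * ?Q' z) - 1) \<le> \<bar>\<theta>\<bar> * ?Q' z"
          using norm_iexp_diff_1_le(1)[of "\<theta> * ?Q' z"] Q0 by (simp add: abs_mult)
        ultimately have "cmod (iexp (\<theta> * ?Q' z) - 1) \<le> \<bar>\<theta>\<bar> * (real N * R)" by linarith
        then have "cmod (?F z) \<le> (\<bar>\<theta>\<bar> * (real N * R)) * (\<bar>\<theta>\<bar> * unused' z)"
          unfolding norm_mult using U assms by (intro mult_mono) auto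
        also have "\<dots> = \<theta>\<^sup>2 * (real N * R) * unused' z"
          by (simp add: power2_eq_square)
        finally show ?thesis using A by simp
      qed
    qed
    then show "AE z in ?J. cmod (?F z) \<le> \<theta>\<^sup>2 * (real N * R) * unused' z + 2 * \<bar>\<theta>\<bar> * (real N * C) * indicator ?A z"
      by (simp only: AE_measure_pmf_iff) blast
  qed
  also have "\<dots> = \<theta>\<^sup>2 * (real N * R) * measure_pmf.expectation ?J unused'
      + 2 * \<bar>\<theta>\<bar> * (real N * C) * measure_pmf.prob ?J ?A"
  proof -
    have "integrable (measure_pmf ?J) (indicator ?A :: _ \<Rightarrow> real)"
      by (intro integrable_measure_pmf_bounded[of _ _ 1]) (simp add: indicator_def)
    then show ?thesis using integrable_unused by simp
  qed
  \<comment> \<open>The spread in \<open>?A\<close> is that after the slot; by stationarity it has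
    the same law as the spread before it.\<close>
  also have "measure_pmf.prob ?J ?A = measure_pmf.prob \<rho> {z. R \<le> spread {1..N} (\<lambda>j. real (fst z j))}"
  proof -
    have "measure_pmf.prob ?J ?A =
        measure_pmf.prob (map_pmf (\<lambda>((x, i), w). jsq_step N x i w) ?J) {x. R \<le> spread {1..N} (\<lambda>j. real (x j))}"
      by (simp add: vimage_def case_prod_unfold)
    then show ?thesis unfolding stationary by (simp add: vimage_def)
  qed
  finally show ?thesis
    unfolding expectation_unused
    by (rule order.trans) (use prob_spread_ge[of R] C_ge_1 in \<open>intro add_left_mono mult_left_mono; simp\<close>)
qed

lemma jobs_char_bound:
  fixes \<theta> R :: real
  assumes "0 \<le> R"
  shows "cmod (jobs_char \<theta> * (\<i> * \<theta> * (N * \<epsilon>) + \<theta>\<^sup>2 / 2 * (N * v + (N * \<epsilon>)\<^sup>2)) - \<i> * \<theta> * (N * \<epsilon>))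
    \<le> \<bar>\<theta>\<bar> ^ 3 * (real N * C) ^ 3 / 6 + \<theta>\<^sup>2 * (real N * C) * (N * \<epsilon>) / 2
      + (\<theta>\<^sup>2 * (real N * R) * (N * \<epsilon>) + 2 * \<bar>\<theta>\<bar> * (real N * C) * (32 / (\<eta> * exp (\<eta> * R))))"
proof -
  let ?J = "pair_pmf \<rho> \<nu>" and ?\<phi> = "jobs_char \<theta>"
  let ?\<psi> = "measure_pmf.expectation \<nu> (\<lambda>w. iexp (\<theta> * total_net N w))"
  let ?Q' = "\<lambda>z. case z of ((x, i), w) \<Rightarrow> jobs N (jsq_step N x i w)"
  define X where "X = measure_pmf.expectation ?J
    (\<lambda>z. (iexp (\<theta> * ?Q' z) - 1) * (iexp (- \<theta> * unused' z) - 1))"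
  define Y where "Y = measure_pmf.expectation ?J (\<lambda>z. iexp (- \<theta> * unused' z) - 1)"
  define T :: complex where "T = \<i> * \<theta> * (N * \<epsilon>)"
  define S :: complex where "S = \<theta>\<^sup>2 / 2 * (N * v + (N * \<epsilon>)\<^sup>2)"
  let ?f = "\<lambda>z. iexp (\<theta> * jobs N (fst (fst z))) * iexp (\<theta> * total_net N (snd z))"
  let ?g = "\<lambda>z. iexp (\<theta> * ?Q' z) + (iexp (- \<theta> * unused' z) - 1)
      + (iexp (\<theta> * ?Q' z) - 1) * (iexp (- \<theta> * unused' z) - 1)"
  have "?\<phi> * ?\<psi> = measure_pmf.expectation ?J ?f"
    by (subst expectation_pair_pmf_complex[of _ 1]) (simp_all add: jobs_char_def case_prod_unfold norm_mult)
  also have "\<dots> = measure_pmf.expectation ?J ?g"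
  proof (rule integral_cong_AE)
    have "?f z = ?g z" if z: "z \<in> set_pmf ?J" for z
    proof -
      obtain x i w where xiw: "z = ((x, i), w)" by (metis prod.exhaust)
      then have "(x, i) \<in> set_pmf \<rho>" using z by simp
      from jobs_jsq_step[OF routing_server[OF this], of x w]
      have "?f z = iexp (\<theta> * ?Q' z) * iexp (- \<theta> * unused' z)"
        by (simp add: xiw exp_add[symmetric] algebra_simps)
      then show ?thesis by (simp add: algebra_simps)
    qed
    then show "AE z in ?J. ?f z = ?g z"
      by (simp only: AE_measure_pmf_iff) blast
  qed auto
  also have "\<dots> = measure_pmf.expectation ?J (\<lambda>z. iexp (\<theta> * ?Q' z)) + Y + X"
  proof -
    let ?u = "\<lambda>z. iexp (\<theta> * ?Q' z)" and ?v = "\<lambda>z. iexp (- \<theta> * unused' z) - 1"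
    have u: "integrable (measure_pmf ?J) ?u"
      by (intro integrable_measure_pmf_bounded[of _ _ 1]) simp
    have v: "integrable (measure_pmf ?J) ?v"
      by (intro integrable_measure_pmf_bounded[of _ _ 2] norm_iexp_diff_1_le(2))
    have uv: "integrable (measure_pmf ?J) (\<lambda>z. (?u z - 1) * ?v z)"
    proof (rule integrable_measure_pmf_bounded)
      show "cmod ((?u z - 1) * ?v z) \<le> 2 * 2" for z
        unfolding norm_mult by (intro mult_mono norm_iexp_diff_1_le(2)) auto
    qed
    show ?thesis
      unfolding X_def Y_def Bochner_Integration.integral_add[OF Bochner_Integration.integrable_add[OF u v] uv]
        Bochner_Integration.integral_add[OF u v] ..
  qed
  also have "measure_pmf.expectation ?J (\<lambda>z. iexp (\<theta> * ?Q' z)) = ?\<phi>"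
    using expectation_next[of "\<lambda>x. iexp (\<theta> * jobs N x)"] by (simp add: jobs_char_def case_prod_unfold)
  finally have eq: "?\<phi> * (T + S) - T = ?\<phi> * (?\<psi> - 1 + T + S) - (Y + T) - X"
    by (simp add: algebra_simps)
  have "cmod (?\<phi> * (T + S) - T) \<le> cmod (?\<phi> * (?\<psi> - 1 + T + S)) + cmod (Y + T) + cmod X"
    unfolding eq by (intro order.trans[OF norm_triangle_ineq4] add_right_mono norm_triangle_ineq4)
  moreover have "cmod (?\<phi> * (?\<psi> - 1 + T + S)) \<le> 1 * cmod (?\<psi> - 1 + T + S)"
    unfolding norm_mult using norm_jobs_char_le by (intro mult_right_mono) auto
  ultimately show ?thesis
    using net_char_expansion[of \<theta>] unused_char_expansion[of \<theta>] cross_term_le[OF assms, of \<theta>]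
    unfolding T_def S_def X_def Y_def by linarith
qed

end

section \<open>The kernel of the queue length process\<close>

lemma (in prob_space) measure_pmf_Abs_pmf_distr:
  fixes X :: "'a \<Rightarrow> 'b::countable"
  assumes X: "X \<in> measurable M (count_space UNIV)"
  shows "measure_pmf (Abs_pmf (distr M (count_space UNIV) X)) = distr M (count_space UNIV) X"
proof (rule Abs_pmf_inverse, intro CollectI conjI)
  interpret D: prob_space "distr M (count_space UNIV) X" using X by (rule prob_space_distr)
  show "prob_space (distr M (count_space UNIV) X)" by (rule D.prob_space_axioms)
  show "AE x in distr M (count_space UNIV) X. measure (distr M (count_space UNIV) X) {x} \<noteq> 0"
    by (subst D.AE_support_countable) (auto intro!: exI[of _ UNIV])
qed simp

text \<open>Such a function is determined by its list of values on \<open>A\<close>. The full type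
  of functions on the naturals is uncountable, whereas the kernel below is computed by countable
  additivity over the possible inputs.\<close>

lemma countable_finite_support:
  assumes "finite A"
  shows "countable {w :: 'a \<Rightarrow> 'b::countable. \<forall>l. l \<notin> A \<longrightarrow> w l = d}"
proof -
  obtain xs where xs: "set xs = A" using finite_list[OF assms] by blast
  have "inj_on (\<lambda>w. map w xs) {w :: 'a \<Rightarrow> 'b. \<forall>l. l \<notin> A \<longrightarrow> w l = d}"
  proof (intro inj_onI ext)
    fix v w :: "'a \<Rightarrow> 'b" and l
    assume "v \<in> {w. \<forall>l. l \<notin> A \<longrightarrow> w l = d}" "w \<in> {w. \<forall>l. l \<notin> A \<longrightarrow> w l = d}" "map v xs = map w xs"
    then show "v l = w l" using xs by (cases "l \<in> A") auto
  qed
  then show ?thesis by (rule countableI')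
qed

section \<open>States that the chain visits with positive probability\<close>

context markov_chain
begin

definition path_event :: "nat \<Rightarrow> (nat \<Rightarrow> 'x) \<Rightarrow> 'w set" where
  "path_event k y = {\<omega> \<in> space M. \<forall>j\<le>k. X j \<omega> = y j}"

lemma sets_path_event: "path_event k y \<in> events"
proof -
  have "{\<omega> \<in> space M. X j \<omega> = y j} \<in> events" for j
    using measurable_sets[OF X_measurable[of j], of "{y j}"]
    by (rule back_subst[of "\<lambda>A. A \<in> events"]) auto
  then have "(\<Inter>j\<in>{..k}. {\<omega> \<in> space M. X j \<omega> = y j}) \<in> events"
    by (intro sets.finite_INT) auto
  also have "(\<Inter>j\<in>{..k}. {\<omega> \<in> space M. X j \<omega> = y j}) = path_event k y" by (auto simp: path_event_def)
  finally show ?thesis .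
qed

lemma prob_path_event_Suc:
  "prob (path_event (Suc k) (y(Suc k := z))) = prob (path_event k y) * pmf (K (y k)) z"
proof -
  have "path_event k (y(Suc k := z)) = path_event k y" by (auto simp: path_event_def)
  then show ?thesis using markov_property[of k "y(Suc k := z)"] by (simp add: path_event_def)
qed

text \<open>Induction on \<open>n\<close>: the first of the remaining steps is moved to the end of
  the path, so \<open>k\<close> and \<open>y\<close> have to vary.\<close>

lemma path_event_extend:
  assumes "0 < prob (path_event k y)" "0 < pmf (n_step K n (y k)) z"
  shows "\<exists>k' y'. 0 < prob (path_event k' y') \<and> y' k' = z"
  using assms
proof (induction n arbitrary: k y)
  case 0
  then have "y k = z" by (cases "y k = z") simp_all
  with 0 show ?case by (intro exI[of _ k] exI[of _ y]) simp
next
  case (Suc n)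
  from Suc.prems(2) have "z \<in> set_pmf (bind_pmf (K (y k)) (n_step K n))"
    unfolding n_step.simps pmf_positive_iff .
  then obtain u where u: "u \<in> set_pmf (K (y k))" "z \<in> set_pmf (n_step K n u)" by auto
  let ?y = "y(Suc k := u)"
  have "prob (path_event (Suc k) ?y) = prob (path_event k y) * pmf (K (y k)) u"
    by (rule prob_path_event_Suc)
  also have "\<dots> > 0" using Suc.prems(1) u(1) by (simp add: pmf_positive)
  finally have "0 < prob (path_event (Suc k) ?y)" .
  moreover have "0 < pmf (n_step K n (?y (Suc k))) z" using u(2) by (simp add: pmf_positive)
  ultimately show ?case by (rule Suc.IH)
qed

text \<open>The Markov property ties \<open>K x\<close> to the process only along paths of positive
  probability that end in \<open>x\<close>. Irreducibility extends a suitable initial state to such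
  a path for every state of \<open>E\<close>.\<close>

lemma every_state_visited:
  assumes irr: "irreducible_chain E K" and z: "z \<in> E"
  shows "\<exists>k y. 0 < prob (path_event k y) \<and> y k = z"
proof -
  \<comment> \<open>If every initial state were null, countability of \<open>E\<close> would put the
    start of the chain outside of \<open>E\<close> almost surely.\<close>
  have "\<exists>x\<in>E. 0 < prob (path_event 0 (\<lambda>_. x))"
  proof (rule ccontr)
    assume contra: "\<not> ?thesis"
    have null: "prob (path_event 0 (\<lambda>_. x)) = 0" if "x \<in> E" for x
    proof (rule ccontr)
      assume "prob (path_event 0 (\<lambda>_. x)) \<noteq> 0"
      then have "0 < prob (path_event 0 (\<lambda>_. x))" by (simp only: zero_less_measure_iff not_False_eq_True)
      with contra that show False by (elim notE) (rule bexI)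
    qed
    have "AE \<omega> in M. X 0 \<omega> \<noteq> x" if "x \<in> E" for x
    proof (rule AE_I)
      show "emeasure M (path_event 0 (\<lambda>_. x)) = 0"
        using null[OF that] by (simp only: emeasure_eq_measure ennreal_0)
      show "path_event 0 (\<lambda>_. x) \<in> events" by (rule sets_path_event)
    qed (auto simp: path_event_def)
    then have "AE \<omega> in M. \<forall>x\<in>E. X 0 \<omega> \<noteq> x"
      unfolding AE_ball_countable[OF countable_state_space] by blast
    with X_in_state_space[of 0] have "AE \<omega> in M. False" by eventually_elim auto
    then show False by simp
  qed
  then obtain x where x: "x \<in> E" "0 < prob (path_event 0 (\<lambda>_. x))" by (elim bexE)
  obtain n where "0 < pmf (n_step K n x) z"
    using irr[unfolded irreducible_chain_def, rule_format, OF x(1) z] by (elim exE)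
  then show ?thesis by (rule path_event_extend[OF x(2)])
qed

end

section \<open>The law of the input of one slot\<close>

context jsq_system
begin

definition primitive :: "nat \<Rightarrow> nat \<Rightarrow> 'w \<Rightarrow> nat" where
  "primitive l k = (if l = 0 then a k else s l k)"

definition primitive_law :: "nat \<Rightarrow> nat pmf" where
  "primitive_law l = Abs_pmf (distr M (count_space UNIV) (primitive l 1))"

text \<open>The default value 0 of \<open>Pi_pmf\<close> outside of \<open>{0..N}\<close> agrees
  with that of \<open>input\<close>, so both range over the same countable set of functions.\<close>

definition input_law :: "(nat \<Rightarrow> nat) pmf" where
  "input_law = Pi_pmf {0..N} 0 primitive_law"

definition input :: "nat \<Rightarrow> 'w \<Rightarrow> nat \<Rightarrow> nat" where
  "input k \<omega> l = (if l \<le> N then primitive l k \<omega> else 0)"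

lemma indep_vars_primitive:
  "indep_vars (\<lambda>_. count_space UNIV) (\<lambda>(l, k). primitive l k) ({0..N} \<times> UNIV)"
  using indep_primitives by (simp add: primitive_def cong: if_cong)

lemma primitive_measurable:
  assumes "l \<le> N"
  shows "primitive l k \<in> measurable M (count_space UNIV)"
proof -
  have "(case (l, k) of (l, k) \<Rightarrow> primitive l k) \<in> measurable M (count_space UNIV)"
    using indep_vars_primitive unfolding indep_vars_def by (rule bspec[OF conjunct1]) (use assms in auto)
  then show ?thesis by simp
qed

lemma primitive_distr:
  assumes "l \<le> N"
  shows "distr M (count_space UNIV) (primitive l k) = measure_pmf (primitive_law l)"
proof -
  have "distr M (count_space UNIV) (primitive l k) = distr M (count_space UNIV) (primitive l 1)"
    using assms a_identically_distributed[of k] s_identically_distributed[of l k]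
    by (simp add: primitive_def)
  also have "\<dots> = measure_pmf (primitive_law l)"
    unfolding primitive_law_def using primitive_measurable[OF assms] by (rule measure_pmf_Abs_pmf_distr[symmetric])
  finally show ?thesis .
qed

lemma prob_primitive:
  assumes "l \<le> N"
  shows "prob {\<omega> \<in> space M. primitive l k \<omega> = n} = pmf (primitive_law l) n"
proof -
  have "pmf (primitive_law l) n = measure (distr M (count_space UNIV) (primitive l k)) {n}"
    by (simp add: primitive_distr[OF assms] measure_pmf_single)
  also have "\<dots> = prob (primitive l k -` {n} \<inter> space M)"
    using primitive_measurable[OF assms] by (rule measure_distr) simp
  also have "primitive l k -` {n} \<inter> space M = {\<omega> \<in> space M. primitive l k \<omega> = n}" by auto
  finally show ?thesis ..
qed

lemma prob_input:
  assumes w: "\<forall>l. l \<notin> {0..N} \<longrightarrow> w l = 0"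
  shows "prob {\<omega> \<in> space M. a k \<omega> = w 0 \<and> (\<forall>l\<in>{1..N}. s l k \<omega> = w l)} = pmf input_law w"
proof -
  have "{\<omega> \<in> space M. a k \<omega> = w 0 \<and> (\<forall>l\<in>{1..N}. s l k \<omega> = w l)} =
      (\<Inter>i\<in>{0..N} \<times> {k}. (case i of (l, k) \<Rightarrow> primitive l k) -` {w (fst i)} \<inter> space M)"
    (is "?A = ?B")
  proof
    show "?A \<subseteq> ?B" by (auto simp: primitive_def)
    show "?B \<subseteq> ?A"
    proof
      fix \<omega> assume "\<omega> \<in> ?B"
      then have *: "\<omega> \<in> space M" "primitive l k \<omega> = w l" if "l \<in> {0..N}" for l
        using that by auto
      have "s l k \<omega> = w l" if "l \<in> {1..N}" for l
        using *(2)[of l] that by (simp add: primitive_def)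
      then show "\<omega> \<in> ?A" using *[of 0] by (simp add: primitive_def)
    qed
  qed
  also have "prob \<dots> = (\<Prod>i\<in>{0..N} \<times> {k}. prob ((case i of (l, k) \<Rightarrow> primitive l k) -` {w (fst i)} \<inter> space M))"
    by (rule indep_varsD[OF indep_vars_primitive]) auto
  also have "\<dots> = (\<Prod>l\<in>{0..N}. prob {\<omega> \<in> space M. primitive l k \<omega> = w l})"
    by (rule prod.reindex_bij_witness[of _ "\<lambda>l. (l, k)" fst])
      (auto intro!: arg_cong[where f = prob])
  also have "\<dots> = (\<Prod>l\<in>{0..N}. pmf (primitive_law l) (w l))"
    by (intro prod.cong) (simp_all add: prob_primitive)
  also have "\<dots> = pmf input_law w"
    unfolding input_law_def using w by (subst pmf_Pi') auto
  finally show ?thesis .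
qed

lemma input_eq_iff:
  assumes "\<forall>l. l \<notin> {0..N} \<longrightarrow> w l = 0"
  shows "input k \<omega> = w \<longleftrightarrow> a k \<omega> = w 0 \<and> (\<forall>l\<in>{1..N}. s l k \<omega> = w l)"
proof
  assume "input k \<omega> = w"
  then have *: "input k \<omega> l = w l" for l by simp
  have "s l k \<omega> = w l" if "l \<in> {1..N}" for l
    using *[of l] that by (simp add: input_def primitive_def)
  then show "a k \<omega> = w 0 \<and> (\<forall>l\<in>{1..N}. s l k \<omega> = w l)"
    using *[of 0] by (simp add: input_def primitive_def)
next
  assume R: "a k \<omega> = w 0 \<and> (\<forall>l\<in>{1..N}. s l k \<omega> = w l)"
  show "input k \<omega> = w"
  proof
    fix l show "input k \<omega> l = w l"
      using R assms by (cases "l = 0"; cases "l \<le> N") (auto simp: input_def primitive_def)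
  qed
qed

lemma q_Suc:
  assumes "\<omega> \<in> space M"
  shows "q (Suc k) \<omega> = jsq_step N (q k \<omega>) (istar k \<omega>) (input k \<omega>)"
proof
  fix j
  show "q (Suc k) \<omega> j = jsq_step N (q k \<omega>) (istar k \<omega>) (input k \<omega>) j"
  proof (cases "j \<in> {1..N}")
    case True
    then have "int (q (Suc k) \<omega> j) = int (jsq_step N (q k \<omega>) (istar k \<omega>) (input k \<omega>) j)"
      using dynamics[OF assms True, of k]
      by (auto simp: jsq_step_def input_def primitive_def max_def)
    then show ?thesis by simp
  next
    case False
    then show ?thesis using q_support[OF assms False] by (auto simp: jsq_step_def)
  qed
qed

end

text \<open>Additivity of variances for centred variables. By induction each new summand is
  independent of the partial sum and has mean 0, so the mixed product has mean 0; the almost sure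
  bounds supply integrability.\<close>

lemma (in prob_space) expectation_sum_square_indep:
  fixes Y :: "'i \<Rightarrow> 'a \<Rightarrow> real"
  assumes "finite I" "indep_vars (\<lambda>_. borel) Y I"
    and bound: "\<And>i \<omega>. i \<in> I \<Longrightarrow> AE \<omega> in M. \<bar>Y i \<omega>\<bar> \<le> b i"
    and "\<And>i. i \<in> I \<Longrightarrow> expectation (Y i) = 0"
  shows "expectation (\<lambda>\<omega>. (\<Sum>i\<in>I. Y i \<omega>)\<^sup>2) = (\<Sum>i\<in>I. expectation (\<lambda>\<omega>. (Y i \<omega>)\<^sup>2))"
  using assms
proof (induction I)
  case empty
  then show ?case by simp
next
  case (insert i I)
  let ?S = "\<lambda>\<omega>. \<Sum>j\<in>I. Y j \<omega>"
  have meas: "Y j \<in> borel_measurable M" if "j \<in> insert i I" for j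
    using insert.prems(1) that unfolding indep_vars_def by blast
  have int: "integrable M (Y j)" if "j \<in> insert i I" for j
    using insert.prems(2)[OF that] meas[OF that] by (intro integrable_const_bound[of _ "b j"]) auto
  have Y2: "integrable M (\<lambda>\<omega>. (Y i \<omega>)\<^sup>2)"
  proof (rule integrable_const_bound)
    have "AE \<omega> in M. \<bar>Y i \<omega>\<bar> \<le> b i" using insert.prems(2) by simp
    then show "AE \<omega> in M. norm ((Y i \<omega>)\<^sup>2) \<le> (b i)\<^sup>2"
      by eventually_elim (simp add: abs_le_square_iff[symmetric])
  qed (use meas in auto)
  have S2: "integrable M (\<lambda>\<omega>. (?S \<omega>)\<^sup>2)"
  proof (rule integrable_const_bound)
    have "AE \<omega> in M. \<forall>j\<in>I. \<bar>Y j \<omega>\<bar> \<le> b j"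
      using insert.prems(2) insert.hyps(1) by (auto intro!: AE_finite_allI)
    then show "AE \<omega> in M. norm ((?S \<omega>)\<^sup>2) \<le> (\<Sum>j\<in>I. b j)\<^sup>2"
    proof eventually_elim
      case (elim \<omega>)
      then have "\<bar>?S \<omega>\<bar> \<le> (\<Sum>j\<in>I. b j)" by (intro order.trans[OF sum_abs] sum_mono) auto
      then have "\<bar>?S \<omega>\<bar>\<^sup>2 \<le> (\<Sum>j\<in>I. b j)\<^sup>2" by (intro power_mono) auto
      then show ?case by simp
    qed
  qed (use meas in auto)
  have indep: "indep_var borel (Y i) borel ?S"
    by (rule indep_vars_sum[OF insert.hyps insert.prems(1)])
  have intS: "integrable M ?S" using int by auto
  have "integrable M (\<lambda>\<omega>. Y i \<omega> * ?S \<omega>)" "expectation (\<lambda>\<omega>. Y i \<omega> * ?S \<omega>) = 0"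
    using indep_var_integrable[OF indep int intS] indep_var_lebesgue_integral[OF indep int intS]
      insert.prems(3) by auto
  moreover have "expectation (\<lambda>\<omega>. (?S \<omega>)\<^sup>2) = (\<Sum>j\<in>I. expectation (\<lambda>\<omega>. (Y j \<omega>)\<^sup>2))"
    using insert.prems by (intro insert.IH indep_vars_subset[OF insert.prems(1)]) auto
  moreover have "(\<Sum>j\<in>insert i I. Y j \<omega>)\<^sup>2 = (Y i \<omega>)\<^sup>2 + (2 * (Y i \<omega> * ?S \<omega>) + (?S \<omega>)\<^sup>2)" for \<omega>
    using insert.hyps by (simp add: power2_eq_square algebra_simps)
  ultimately show ?case using insert.hyps Y2 S2 by simp
qed

section \<open>Bounds and moments of the input law\<close>

context jsq_system
begin

lemma input_law_component: "l \<le> N \<Longrightarrow> map_pmf (\<lambda>w. w l) input_law = primitive_law l"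
  unfolding input_law_def by (subst Pi_pmf_component) auto

lemma expectation_input_law:
  fixes f :: "nat \<Rightarrow> real"
  assumes "l \<le> N"
  shows "measure_pmf.expectation input_law (\<lambda>w. f (w l)) = expectation (\<lambda>\<omega>. f (primitive l 1 \<omega>))"
proof -
  have "measure_pmf.expectation input_law (\<lambda>w. f (w l)) = measure_pmf.expectation (primitive_law l) f"
    unfolding input_law_component[OF assms, symmetric] by simp
  also have "\<dots> = integral\<^sup>L (distr M (count_space UNIV) (primitive l 1)) f"
    by (simp only: primitive_distr[OF assms])
  also have "\<dots> = expectation (\<lambda>\<omega>. f (primitive l 1 \<omega>))"
    using primitive_measurable[OF assms] by (rule integral_distr) simp
  finally show ?thesis .
qed

text \<open>A property that holds almost surely holds at every atom of a discrete law.\<close>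

lemma input_law_bound:
  assumes "w \<in> set_pmf input_law" "l \<le> N" and ae: "AE \<omega> in M. R (primitive l 1 \<omega>)"
  shows "R (w l)"
proof -
  have "w l \<in> set_pmf (primitive_law l)"
    using assms(1) unfolding input_law_component[OF assms(2), symmetric] by simp
  moreover have "AE n in distr M (count_space UNIV) (primitive l 1). R n"
    using ae by (subst AE_distr_iff[OF primitive_measurable[OF assms(2)]]) auto
  then have "\<forall>n\<in>set_pmf (primitive_law l). R n"
    unfolding primitive_distr[OF assms(2)] AE_measure_pmf_iff .
  ultimately show ?thesis by blast
qed

text \<open>The 1 in the maximum secures \<open>C_ge_1\<close>, whatever the values of
  \<open>A_max\<close> and \<open>S_max\<close>.\<close>

definition cap :: real where
  "cap = max 1 (max A_max S_max)"

lemma input_law_arrivals_le: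
  assumes "w \<in> set_pmf input_law"
  shows "real (w 0) \<le> real N * cap"
  using assms
proof (rule input_law_bound[where R = "\<lambda>n. real n \<le> real N * cap"])
  have "real N * A_max \<le> real N * cap" by (intro mult_left_mono) (auto simp: cap_def)
  with a_bounded show "AE \<omega> in M. real (primitive 0 1 \<omega>) \<le> real N * cap"
    unfolding primitive_def by (auto elim!: eventually_mono)
qed auto

lemma input_law_services_le:
  assumes "w \<in> set_pmf input_law" "l \<in> {1..N}"
  shows "real (w l) \<le> cap"
  using assms(1)
proof (rule input_law_bound[where R = "\<lambda>n. real n \<le> cap"])
  show "AE \<omega> in M. real (primitive l 1 \<omega>) \<le> cap"
    using s_bounded[OF assms(2)] assms(2) unfolding primitive_def
    by (auto elim!: eventually_mono simp: cap_def)
qed (use assms in auto)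

lemma input_law_mean_arrivals:
  "measure_pmf.expectation input_law (\<lambda>w. real (w 0)) = real N * (1 - real N powr (-\<alpha>))"
  by (subst expectation_input_law) (simp_all add: primitive_def expectation_a[simplified])

lemma input_law_mean_services:
  "l \<in> {1..N} \<Longrightarrow> measure_pmf.expectation input_law (\<lambda>w. real (w l)) = 1"
  using expectation_s[of l] by (subst expectation_input_law) (simp_all add: primitive_def)

text \<open>The net input is a sum of independent centred coordinates plus its mean. The arrivals
  contribute \<open>N * \<sigma>\<^sub>a\<^sup>2\<close> and each of the \<open>N\<close> servers
  \<open>\<sigma>\<^sub>s\<^sup>2\<close>.\<close>

lemma input_law_second_moment:
  "measure_pmf.expectation input_law (\<lambda>w. (total_net N w)\<^sup>2) =
    real N * (\<sigma>\<^sub>a\<^sup>2 + \<sigma>\<^sub>s\<^sup>2) + (real N * real N powr (-\<alpha>))\<^sup>2"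
proof -
  let ?\<nu> = "measure_pmf input_law" and ?E = "measure_pmf.expectation input_law"
  define m where "m l = (if l = 0 then real N * (1 - real N powr (-\<alpha>)) else 1)" for l :: nat
  \<comment> \<open>Services get the opposite sign, so that summing the centred coordinates gives
    the centred net input.\<close>
  define g where "g l n = (if l = 0 then real n - m l else m l - real n)" for l n :: nat
  have coord_bound: "real (w l) \<le> real N * cap + cap" if "w \<in> set_pmf input_law" "l \<le> N" for w l
  proof -
    have "0 \<le> cap" "0 \<le> real N * cap" by (auto simp: cap_def)
    then show ?thesis
      using input_law_arrivals_le[OF that(1)] input_law_services_le[OF that(1), of l] that(2)
      by (cases "l = 0") auto
  qed
  have int: "integrable ?\<nu> (\<lambda>w. real (w l))" if "l \<le> N" for l
    using coord_bound that by (intro integrable_measure_pmf_bounded[of _ _ "real N * cap + cap"]) auto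
  have mean: "?E (\<lambda>w. real (w l)) = m l" if "l \<le> N" for l
    using that input_law_mean_arrivals input_law_mean_services[of l] by (cases "l = 0") (auto simp: m_def)
  have int_g: "integrable ?\<nu> (\<lambda>w. g l (w l))" if "l \<le> N" for l
    using int[OF that] by (cases "l = 0") (auto simp: g_def)
  have mean_g: "?E (\<lambda>w. g l (w l)) = 0" if "l \<le> N" for l
    using int[OF that] mean[OF that] by (cases "l = 0") (auto simp: g_def)
  have indep: "prob_space.indep_vars (measure_pmf input_law) (\<lambda>_. borel) (\<lambda>l w. g l (w l)) {0..N}"
    using prob_space.indep_vars_compose2[OF prob_space_measure_pmf indep_vars_Pi_pmf[of "{0..N}" 0 primitive_law],
        of g "\<lambda>_. borel"] unfolding input_law_def by simp
  have square_g: "?E (\<lambda>w. (g l (w l))\<^sup>2) = (if l = 0 then real N * \<sigma>\<^sub>a\<^sup>2 else \<sigma>\<^sub>s\<^sup>2)" if "l \<le> N" for l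
  proof (cases "l = 0")
    case True
    have "?E (\<lambda>w. (g l (w l))\<^sup>2) = expectation (\<lambda>\<omega>. (g l (primitive l 1 \<omega>))\<^sup>2)"
      using expectation_input_law[OF that, of "\<lambda>n. (g l n)\<^sup>2"] .
    also have "\<dots> = real N * \<sigma>\<^sub>a\<^sup>2"
      using variance_a True unfolding expectation_a by (simp add: g_def m_def primitive_def)
    finally show ?thesis using True by simp
  next
    case False
    have l: "l \<in> {1..N}" using False that by auto
    have "?E (\<lambda>w. (g l (w l))\<^sup>2) = expectation (\<lambda>\<omega>. (g l (primitive l 1 \<omega>))\<^sup>2)"
      using expectation_input_law[OF that, of "\<lambda>n. (g l n)\<^sup>2"] .
    also have "\<dots> = \<sigma>\<^sub>s\<^sup>2"
      using variance_s[OF l] False unfolding expectation_s[OF l]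
      by (simp add: g_def m_def primitive_def power2_commute)
    finally show ?thesis using False by simp
  qed
  let ?S = "\<lambda>w. \<Sum>l\<in>{0..N}. g l (w l)"
  have split0: "(\<Sum>l\<in>{0..N}. f l) = f 0 + (\<Sum>l=1..N. f l)" for f :: "nat \<Rightarrow> real"
    by (simp add: sum.atLeast_Suc_atMost)
  have net: "total_net N w = ?S w - real N * real N powr (-\<alpha>)" for w
    unfolding split0 by (simp add: total_net_def jobs_def g_def m_def sum_subtractf algebra_simps)
  have "\<bar>g l (w l)\<bar> \<le> real N * cap + cap + \<bar>m l\<bar>" if "w \<in> set_pmf input_law" "l \<le> N" for w l
    using coord_bound[OF that] by (auto simp: g_def abs_le_iff)
  then have "?E (\<lambda>w. (?S w)\<^sup>2) = (\<Sum>l\<in>{0..N}. ?E (\<lambda>w. (g l (w l))\<^sup>2))"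
    by (intro prob_space.expectation_sum_square_indep[OF prob_space_measure_pmf, where b = "\<lambda>l. real N * cap + cap + \<bar>m l\<bar>"] indep mean_g)
      (auto simp: AE_measure_pmf_iff)
  also have "\<dots> = (\<Sum>l\<in>{0..N}. if l = 0 then real N * \<sigma>\<^sub>a\<^sup>2 else \<sigma>\<^sub>s\<^sup>2)"
    by (intro sum.cong) (auto simp: square_g)
  also have "\<dots> = real N * (\<sigma>\<^sub>a\<^sup>2 + \<sigma>\<^sub>s\<^sup>2)"
    unfolding split0 by (simp add: algebra_simps)
  finally have S2: "?E (\<lambda>w. (?S w)\<^sup>2) = real N * (\<sigma>\<^sub>a\<^sup>2 + \<sigma>\<^sub>s\<^sup>2)" .
  have S1: "integrable ?\<nu> ?S" "?E ?S = 0" using int_g mean_g by auto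
  have int_S2: "integrable ?\<nu> (\<lambda>w. (?S w)\<^sup>2)"
  proof (rule integrable_measure_pmf_bounded)
    fix w assume "w \<in> set_pmf input_law"
    then have "\<bar>?S w\<bar> \<le> (\<Sum>l\<in>{0..N}. real N * cap + cap + \<bar>m l\<bar>)"
      using \<open>\<And>w l. w \<in> set_pmf input_law \<Longrightarrow> l \<le> N \<Longrightarrow> \<bar>g l (w l)\<bar> \<le> real N * cap + cap + \<bar>m l\<bar>\<close>
      by (intro order.trans[OF sum_abs] sum_mono) auto
    then have "\<bar>?S w\<bar>\<^sup>2 \<le> (\<Sum>l\<in>{0..N}. real N * cap + cap + \<bar>m l\<bar>)\<^sup>2" by (intro power_mono) auto
    then show "norm ((?S w)\<^sup>2) \<le> (\<Sum>l\<in>{0..N}. real N * cap + cap + \<bar>m l\<bar>)\<^sup>2" by simp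
  qed
  have "?E (\<lambda>w. (total_net N w)\<^sup>2) =
      ?E (\<lambda>w. (?S w)\<^sup>2 - 2 * (real N * real N powr (-\<alpha>)) * ?S w + (real N * real N powr (-\<alpha>))\<^sup>2)"
    unfolding net power2_diff by (intro arg_cong2[where f = "integral\<^sup>L"]) (auto simp: algebra_simps)
  also have "\<dots> = ?E (\<lambda>w. (?S w)\<^sup>2) - 2 * (real N * real N powr (-\<alpha>)) * ?E ?S + (real N * real N powr (-\<alpha>))\<^sup>2"
    using int_S2 S1(1) by simp
  finally show ?thesis unfolding S2 S1(2) by simp
qed

text \<open>Identifies the abstract kernel with one JSQ slot. Along a path of positive probability
  that ends in \<open>x\<close>, the probability of the next state is computed twice: by the Markov
  property, and by summing over the chosen queue and the input, which is independent of path and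
  choice. Dividing by the probability of the path gives \<open>K x\<close>, with
  \<open>\<iota>\<close> the conditional law of the chosen queue.\<close>

lemma kernel_eq:
  assumes chain: "markov_chain M E K q" and irr: "irreducible_chain E K" and x: "x \<in> E"
  shows "\<exists>\<iota>. set_pmf \<iota> \<subseteq> shortest_queues N x \<and>
    K x = map_pmf (\<lambda>(i, w). jsq_step N x i w) (pair_pmf \<iota> input_law)"
proof -
  interpret C: markov_chain M E K q by (rule chain)
  from C.every_state_visited[OF irr x]
  obtain k where "\<exists>y. 0 < prob (C.path_event k y) \<and> y k = x" ..
  then obtain y where y: "0 < prob (C.path_event k y) \<and> y k = x" ..
  note pos = conjunct1[OF y] and yk = conjunct2[OF y]
  define P where "P = C.path_event k y"
  have P_iff: "\<omega> \<in> P \<longleftrightarrow> \<omega> \<in> space M \<and> (\<forall>j\<le>k. q j \<omega> = y j)" for \<omega>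
    by (simp add: P_def C.path_event_def)
  have P: "P \<in> events" "emeasure M P \<noteq> 0" "emeasure M P \<noteq> \<infinity>" "0 < prob P"
    using pos C.sets_path_event[of k y] by (auto simp: P_def emeasure_eq_measure)
  have istar_sets: "{\<omega> \<in> space M. istar k \<omega> = i} \<in> events" for i
    using measurable_sets[OF istar_measurable[of k], of "{i}"]
    by (rule back_subst[of "\<lambda>A. A \<in> events"]) auto
  let ?U = "uniform_measure M P"
  interpret U: prob_space ?U using P(2,3) by (rule prob_space_uniform_measure)
  have istar_U: "istar k \<in> measurable ?U (count_space UNIV)"
    using istar_measurable[of k] by (simp cong: measurable_cong_sets)
  define \<iota> where "\<iota> = Abs_pmf (distr ?U (count_space UNIV) (istar k))"
  have \<iota>: "measure_pmf \<iota> = distr ?U (count_space UNIV) (istar k)"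
    unfolding \<iota>_def using istar_U by (rule U.measure_pmf_Abs_pmf_distr)
  have prob_istar: "prob {\<omega> \<in> space M. (\<forall>j\<le>k. q j \<omega> = y j) \<and> istar k \<omega> = i} = prob P * pmf \<iota> i" for i
  proof -
    have "pmf \<iota> i = measure ?U (istar k -` {i} \<inter> space ?U)"
      using istar_U by (simp add: measure_pmf_single[symmetric] \<iota> measure_distr)
    also have "istar k -` {i} \<inter> space ?U = {\<omega> \<in> space M. istar k \<omega> = i}" by auto
    also have "measure ?U \<dots> = prob (P \<inter> {\<omega> \<in> space M. istar k \<omega> = i}) / prob P"
      using P istar_sets by (intro measure_uniform_measure)
    also have "P \<inter> {\<omega> \<in> space M. istar k \<omega> = i} =
        {\<omega> \<in> space M. (\<forall>j\<le>k. q j \<omega> = y j) \<and> istar k \<omega> = i}"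
      by (auto simp: P_iff)
    finally show ?thesis using P(4) by simp
  qed
  have shortest: "set_pmf \<iota> \<subseteq> shortest_queues N x"
  proof
    fix i assume "i \<in> set_pmf \<iota>"
    then have "0 < prob P * pmf \<iota> i" using P(4) by (simp add: pmf_positive)
    then have "{\<omega> \<in> space M. (\<forall>j\<le>k. q j \<omega> = y j) \<and> istar k \<omega> = i} \<noteq> {}"
      unfolding prob_istar[symmetric] by (metis measure_empty less_irrefl)
    then obtain \<omega> where "\<omega> \<in> space M" "q k \<omega> = x" "istar k \<omega> = i" using yk by auto
    then show "i \<in> shortest_queues N x" using jsq_routing[of \<omega> k] by simp
  qed
  define S where "S = {w :: nat \<Rightarrow> nat. \<forall>l. l \<notin> {0..N} \<longrightarrow> w l = 0}"
  define F where "F c = {\<omega> \<in> space M. ((\<forall>j\<le>k. q j \<omega> = y j) \<and> istar k \<omega> = fst c) \<and>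
    (a k \<omega> = snd c 0 \<and> (\<forall>l\<in>{1..N}. s l k \<omega> = snd c l))}" for c :: "nat \<times> (nat \<Rightarrow> nat)"
  have F_sets: "F c \<in> events" for c
  proof -
    have prim: "{\<omega> \<in> space M. primitive l k \<omega> = n} \<in> events" if "l \<le> N" for l n
      using measurable_sets[OF primitive_measurable[OF that, of k], of "{n}"]
      by (rule back_subst[of "\<lambda>A. A \<in> events"]) auto
    have "F c = P \<inter> {\<omega> \<in> space M. istar k \<omega> = fst c} \<inter>
        (\<Inter>l\<in>{0..N}. {\<omega> \<in> space M. primitive l k \<omega> = snd c l})"
    proof (intro equalityI subsetI)
      fix \<omega> assume "\<omega> \<in> F c"
      then show "\<omega> \<in> P \<inter> {\<omega> \<in> space M. istar k \<omega> = fst c} \<inter>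
          (\<Inter>l\<in>{0..N}. {\<omega> \<in> space M. primitive l k \<omega> = snd c l})"
        by (auto simp: F_def P_iff primitive_def)
    next
      fix \<omega> assume "\<omega> \<in> P \<inter> {\<omega> \<in> space M. istar k \<omega> = fst c} \<inter>
          (\<Inter>l\<in>{0..N}. {\<omega> \<in> space M. primitive l k \<omega> = snd c l})"
      then have *: "\<omega> \<in> P" "\<omega> \<in> space M" "istar k \<omega> = fst c"
        "\<And>l. l \<in> {0..N} \<Longrightarrow> primitive l k \<omega> = snd c l" by auto
      have "s l k \<omega> = snd c l" if "l \<in> {1..N}" for l
        using *(4)[of l] that by (simp add: primitive_def)
      moreover have "a k \<omega> = snd c 0" using *(4)[of 0] by (simp add: primitive_def)
      ultimately show "\<omega> \<in> F c" using *(1-3) by (simp add: F_def P_iff)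
    qed
    then show ?thesis using P(1) istar_sets prim by (auto intro!: sets.finite_INT)
  qed
  have F_prob: "prob (F c) = prob P * pmf (pair_pmf \<iota> input_law) c" if "snd c \<in> S" for c
  proof -
    obtain i w where c: "c = (i, w)" by (cases c)
    have "prob (F c) = prob {\<omega> \<in> space M. (\<forall>j\<le>k. q j \<omega> = y j) \<and> istar k \<omega> = i} *
        prob {\<omega> \<in> space M. a k \<omega> = w 0 \<and> (\<forall>l\<in>{1..N}. s l k \<omega> = w l)}"
      unfolding F_def c fst_conv snd_conv by (rule indep_past)
    then show ?thesis
      using that unfolding prob_istar c S_def by (subst (asm) prob_input) (auto simp: pmf_pair)
  qed
  have input_S: "input k \<omega> \<in> S" for \<omega> by (simp add: S_def input_def)
  have F_iff: "\<omega> \<in> F c \<longleftrightarrow> \<omega> \<in> P \<and> c = (istar k \<omega>, input k \<omega>)" if "snd c \<in> S" for \<omega> c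
    using input_eq_iff[of "snd c" k \<omega>] that by (cases c) (auto simp: F_def P_iff S_def)
  let ?g = "\<lambda>(i, w). jsq_step N x i w"
  have "pmf (K x) z = pmf (map_pmf ?g (pair_pmf \<iota> input_law)) z" for z
  proof -
    define T where "T = {c. snd c \<in> S \<and> ?g c = z}"
    have countable: "countable T"
    proof (rule countable_subset)
      show "T \<subseteq> UNIV \<times> S" by (auto simp: T_def)
      show "countable ((UNIV :: nat set) \<times> S)"
        unfolding S_def by (intro countable_SIGMA countable_finite_support) auto
    qed
    have "prob P * pmf (K x) z = prob (C.path_event (Suc k) (y(Suc k := z)))"
      using C.prob_path_event_Suc[of k y z] yk by (simp add: P_def)
    \<comment> \<open>On \<open>P\<close> the next state is a function of the chosen queue and the
      input, so the event splits into disjoint pieces indexed by the pairs that lead to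
      \<open>z\<close>.\<close>
    also have "C.path_event (Suc k) (y(Suc k := z)) = (\<Union>c\<in>T. F c)"
    proof (intro equalityI subsetI)
      fix \<omega> assume *: "\<omega> \<in> C.path_event (Suc k) (y(Suc k := z))"
      then have \<omega>: "\<omega> \<in> P" "\<omega> \<in> space M" "q (Suc k) \<omega> = z" "q k \<omega> = x"
        using yk by (auto simp: P_iff C.path_event_def)
      then have "(istar k \<omega>, input k \<omega>) \<in> T" using input_S q_Suc[of \<omega> k] by (simp add: T_def)
      moreover have "\<omega> \<in> F (istar k \<omega>, input k \<omega>)" using F_iff \<omega>(1) input_S by simp
      ultimately show "\<omega> \<in> (\<Union>c\<in>T. F c)" by (rule UN_I)
    next
      fix \<omega> assume "\<omega> \<in> (\<Union>c\<in>T. F c)"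
      then obtain c where c: "c \<in> T" "\<omega> \<in> F c" by (rule UN_E)
      then have "c = (istar k \<omega>, input k \<omega>)" "\<omega> \<in> P" using F_iff[of c \<omega>] by (auto simp: T_def)
      then have "q (Suc k) \<omega> = z" "\<omega> \<in> P" "\<omega> \<in> space M"
        using c(1) q_Suc[of \<omega> k] yk by (auto simp: T_def P_iff)
      then show "\<omega> \<in> C.path_event (Suc k) (y(Suc k := z))" by (auto simp: P_iff C.path_event_def le_Suc_eq)
    qed
    finally have eq: "prob P * pmf (K x) z = prob (\<Union>c\<in>T. F c)" .
    have "ennreal (prob P * pmf (K x) z) = emeasure M (\<Union>c\<in>T. F c)"
      unfolding eq by (simp add: emeasure_eq_measure)
    also have "\<dots> = (\<integral>\<^sup>+ c. emeasure M (F c) \<partial>count_space T)"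
    proof (rule emeasure_UN_countable)
      show "disjoint_family_on F T"
        unfolding disjoint_family_on_def using F_iff by (auto simp: T_def)
    qed (use F_sets countable in auto)
    also have "\<dots> = (\<integral>\<^sup>+ c. ennreal (prob P) * ennreal (pmf (pair_pmf \<iota> input_law) c) \<partial>count_space T)"
      by (intro nn_integral_cong) (auto simp: T_def emeasure_eq_measure F_prob ennreal_mult)
    also have "\<dots> = ennreal (prob P) * emeasure (pair_pmf \<iota> input_law) T"
      by (simp add: nn_integral_cmult nn_integral_pmf)
    \<comment> \<open>The two sets differ only in inputs outside of \<open>S\<close>, which
      \<open>input_law\<close> does not charge.\<close>
    also have "emeasure (pair_pmf \<iota> input_law) T = emeasure (pair_pmf \<iota> input_law) (?g -` {z})"
    proof (rule emeasure_eq_AE)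
      have "set_pmf input_law \<subseteq> S"
        unfolding input_law_def S_def by (rule set_Pi_pmf_subset) simp
      then show "AE c in pair_pmf \<iota> input_law. c \<in> T \<longleftrightarrow> c \<in> ?g -` {z}"
        by (auto simp: AE_measure_pmf_iff T_def)
    qed auto
    also have "\<dots> = ennreal (pmf (map_pmf ?g (pair_pmf \<iota> input_law)) z)"
      by (simp add: emeasure_pmf_single[symmetric])
    finally show ?thesis
      using P(4) by (simp add: ennreal_mult[symmetric])
  qed
  then show ?thesis using shortest by (intro exI[of _ \<iota>] conjI pmf_eqI)
qed

end

section \<open>The limit\<close>

text \<open>With \<open>z = \<i> * t - l\<close> the integrand is \<open>l * exp (z * x)\<close>,
  whose antiderivative \<open>l / z * exp (z * x)\<close> vanishes at infinity because the real part
  of \<open>z\<close> is \<open>- l < 0\<close>.\<close>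

lemma char_exponential:
  assumes l: "0 < l"
  shows "char (density lborel (exponential_density l)) t = l / (l - \<i> * t)"
proof -
  interpret D: prob_space "density lborel (exponential_density l)"
    by (rule prob_space_exponential_density[OF l])
  define z where "z = \<i> * t - l"
  have z: "z \<noteq> 0" using l by (auto simp: z_def complex_eq_iff)
  let ?f = "\<lambda>x::real. l * exp (z * x)" and ?F = "\<lambda>x::real. l / z * exp (z * x)"
  have density_eq: "exponential_density l x *\<^sub>R iexp (t * x) = indicator {0..} x *\<^sub>R ?f x" for x
  proof -
    have "z * x = of_real (- x * l) + \<i> * of_real (t * x)" by (simp add: z_def algebra_simps)
    then have "exp (z * x) = of_real (exp (- x * l)) * iexp (t * x)"
      by (simp only: exp_add exp_of_real)
    then show ?thesis by (simp add: exponential_density_def scaleR_conv_of_real)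
  qed
  have "integrable (density lborel (exponential_density l)) (\<lambda>x. iexp (t * x))"
    by (rule D.integrable_const_bound[of _ 1]) auto
  then have int: "integrable lborel (\<lambda>x. indicator {0..} x *\<^sub>R ?f x)"
    unfolding density_eq[symmetric]
    using l by (subst (asm) integrable_density) (auto simp: exponential_density_nonneg)
  \<comment> \<open>The interval integral runs over the open half-line, the density lives on the
    closed one; they differ in the null set \<open>{0}\<close>.\<close>
  have ae: "AE x in lborel. indicator {0..} x *\<^sub>R ?f x = indicator {0<..} x *\<^sub>R ?f x"
    using AE_lborel_singleton[of 0] by eventually_elim (auto simp: indicator_def)
  have interval: "einterval 0 \<infinity> = {0<..}" by (auto simp: einterval_def zero_ereal_def)
  have int': "set_integrable lborel (einterval 0 \<infinity>) ?f"
    unfolding set_integrable_def interval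
    by (rule integrable_cong_AE_imp[OF int]) (use ae in \<open>auto elim!: eventually_mono\<close>)
  have "char (density lborel (exponential_density l)) t = (CLINT x|lborel. indicator {0..} x *\<^sub>R ?f x)"
    unfolding char_def density_eq[symmetric] using l
    by (subst integral_density) (auto simp: exponential_density_nonneg)
  also have "\<dots> = (CLINT x|lborel. indicator {0<..} x *\<^sub>R ?f x)"
    using ae by (intro integral_cong_AE) auto
  also have "\<dots> = (CLBINT x=0..\<infinity>. ?f x)"
    unfolding interval_lebesgue_integral_def set_lebesgue_integral_def interval by simp
  also have "\<dots> = 0 - l / z"
  proof (rule interval_integral_FTC_integrable)
    show "(?F has_vector_derivative ?f x) (at x)" for x
    proof -
      have "((\<lambda>w. l / z * exp (z * w)) has_field_derivative ?f x) (at (of_real x))"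
        using z by (auto intro!: derivative_eq_intros)
      then show ?thesis by (rule has_vector_derivative_real_field)
    qed
    show "isCont ?f x" for x by (intro continuous_intros)
    show "set_integrable lborel (einterval 0 \<infinity>) ?f" by (rule int')
    show "((?F \<circ> real_of_ereal) \<longlongrightarrow> l / z) (at_right 0)"
    proof -
      have "(?F \<longlongrightarrow> l / z * exp (z * of_real 0)) (at_right 0)" by (intro tendsto_intros)
      then show ?thesis by (simp add: zero_ereal_def ereal_tendsto_simps)
    qed
    show "((?F \<circ> real_of_ereal) \<longlongrightarrow> 0) (at_left \<infinity>)"
    proof -
      have "((\<lambda>x. cmod (l / z) * exp (- l * x)) \<longlongrightarrow> 0) at_top"
        using l by real_asymp
      moreover have "cmod (?F x) = cmod (l / z) * exp (- l * x)" for x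
        by (simp only: norm_mult norm_exp_eq_Re) (simp add: z_def)
      ultimately have "((\<lambda>x. cmod (?F x)) \<longlongrightarrow> 0) at_top" by (simp only:)
      then have "(?F \<longlongrightarrow> 0) at_top" by (rule tendsto_norm_zero_cancel)
      then show ?thesis by (simp add: ereal_tendsto_simps)
    qed
  qed simp
  also have "0 - l / z = l / (l - \<i> * t)"
    unfolding z_def by (metis diff_0 minus_diff_eq minus_divide_right)
  finally show ?thesis .
qed

section \<open>From the queue process to one slot in equilibrium\<close>

context jsq_system
begin

text \<open>For two servers the mean number of arrivals \<open>2 - \<delta>\<close> lies strictly
  between 1 and 2. An integer-valued variable keeps a distance of at least
  \<open>min \<delta> (1 - \<delta>)\<close> from it, so its variance is positive. This makes the
  mean of the limit law positive.\<close>

lemma sigma_a_nonzero: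
  assumes N: "N = 2" and alpha: "\<alpha> > 1"
  shows "\<sigma>\<^sub>a \<noteq> 0"
proof
  assume zero: "\<sigma>\<^sub>a = 0"
  define \<delta> where "\<delta> = 2 * 2 powr (-\<alpha>)"
  have "2 powr (-\<alpha>) < 2 powr (-1 :: real)" using alpha by (intro powr_less_mono) auto
  then have \<delta>: "0 < \<delta>" "\<delta> < 1" by (auto simp: \<delta>_def powr_minus)
  have mean: "expectation (\<lambda>\<omega>. real (a 1 \<omega>)) = 2 - \<delta>"
    unfolding expectation_a by (simp add: N \<delta>_def algebra_simps)
  have meas: "a 1 \<in> measurable M (count_space UNIV)"
    using primitive_measurable[of 0 1] by (simp add: primitive_def)
  have "integrable M (\<lambda>\<omega>. (real (a 1 \<omega>) - (2 - \<delta>))\<^sup>2)"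
  proof (rule integrable_const_bound)
    show "AE \<omega> in M. norm ((real (a 1 \<omega>) - (2 - \<delta>))\<^sup>2) \<le> (\<bar>real N * A_max\<bar> + 2)\<^sup>2"
      using a_bounded
    proof eventually_elim
      case (elim \<omega>)
      then have "\<bar>real (a 1 \<omega>) - (2 - \<delta>)\<bar> \<le> \<bar>real N * A_max\<bar> + 2" using \<delta> by (simp add: abs_le_iff)
      then have "\<bar>real (a 1 \<omega>) - (2 - \<delta>)\<bar>\<^sup>2 \<le> (\<bar>real N * A_max\<bar> + 2)\<^sup>2" by (intro power_mono) auto
      then show ?case by simp
    qed
    show "(\<lambda>\<omega>. (real (a 1 \<omega>) - (2 - \<delta>))\<^sup>2) \<in> borel_measurable M"
      using meas by measurable
  qed
  moreover have "(min \<delta> (1 - \<delta>))\<^sup>2 \<le> (real n - (2 - \<delta>))\<^sup>2" for n :: nat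
  proof -
    have "min \<delta> (1 - \<delta>) \<le> \<bar>real n - (2 - \<delta>)\<bar>"
    proof (cases "n \<le> 1")
      case True
      then have "real n \<le> 1" by simp
      then show ?thesis using \<delta> by (simp add: min_def)
    next
      case False
      then have "real n \<ge> 2" by simp
      then show ?thesis using \<delta> by (simp add: min_def)
    qed
    then have "(min \<delta> (1 - \<delta>))\<^sup>2 \<le> \<bar>real n - (2 - \<delta>)\<bar>\<^sup>2" using \<delta> by (intro power_mono) auto
    then show ?thesis by simp
  qed
  ultimately have "(min \<delta> (1 - \<delta>))\<^sup>2 \<le> expectation (\<lambda>\<omega>. (real (a 1 \<omega>) - (2 - \<delta>))\<^sup>2)"
    by (intro integral_ge_const) auto
  moreover have "expectation (\<lambda>\<omega>. (real (a 1 \<omega>) - (2 - \<delta>))\<^sup>2) = 0"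
    using variance_a unfolding mean zero by simp
  ultimately show False using \<delta> by (simp add: min_def split: if_splits)
qed

lemma stationary_jsq_exists:
  assumes N: "2 \<le> N" and alpha: "\<alpha> > 1"
    and chain: "markov_chain M E K q" and irr: "irreducible_chain E K"
    and stat: "stationary_distribution E K \<pi>"
  shows "\<exists>\<rho>. map_pmf fst \<rho> = \<pi> \<and>
    stationary_jsq N cap (real N powr (-\<alpha>)) (\<sigma>\<^sub>a\<^sup>2 + \<sigma>\<^sub>s\<^sup>2) \<rho> input_law"
proof -
  have "\<forall>x. \<exists>\<iota>. x \<in> E \<longrightarrow> set_pmf \<iota> \<subseteq> shortest_queues N x \<and>
      K x = map_pmf (\<lambda>(i, w). jsq_step N x i w) (pair_pmf \<iota> input_law)"
    using kernel_eq[OF chain irr] by blast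
  then obtain \<iota> where \<iota>: "\<And>x. x \<in> E \<Longrightarrow> set_pmf (\<iota> x) \<subseteq> shortest_queues N x"
    "\<And>x. x \<in> E \<Longrightarrow> K x = map_pmf (\<lambda>(i, w). jsq_step N x i w) (pair_pmf (\<iota> x) input_law)"
    by metis
  \<comment> \<open>Queue lengths are drawn from the stationary law, then the chosen queue from its
    conditional law. Adding an independent input and performing the slot amounts to applying
    \<open>K\<close>, so invariance of \<open>\<pi>\<close> becomes the locale's
    \<open>stationary\<close>.\<close>
  define \<rho> where "\<rho> = bind_pmf \<pi> (\<lambda>x. map_pmf (Pair x) (\<iota> x))"
  have \<pi>: "set_pmf \<pi> \<subseteq> E" "bind_pmf \<pi> K = \<pi>" using stat by (auto simp: stationary_distribution_def)
  have fst: "map_pmf fst \<rho> = \<pi>"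
    by (simp add: \<rho>_def map_bind_pmf pmf.map_comp o_def bind_return_pmf')
  have "map_pmf (\<lambda>((x, i), w). jsq_step N x i w) (pair_pmf \<rho> input_law) =
      bind_pmf \<pi> (\<lambda>x. map_pmf (\<lambda>(i, w). jsq_step N x i w) (pair_pmf (\<iota> x) input_law))"
    unfolding \<rho>_def pair_pmf_def map_pmf_def
    by (simp add: bind_assoc_pmf bind_return_pmf)
  also have "\<dots> = bind_pmf \<pi> K"
    using \<pi>(1) \<iota>(2) by (intro bind_pmf_cong) auto
  finally have stationary: "map_pmf (\<lambda>((x, i), w). jsq_step N x i w) (pair_pmf \<rho> input_law) = map_pmf fst \<rho>"
    using \<pi>(2) fst by simp
  have "real N powr (-\<alpha>) \<le> real N powr (-1)" using N alpha by (intro powr_mono) auto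
  also have "\<dots> \<le> 1 / 2" using N by (simp add: powr_minus field_simps)
  finally have eps: "real N powr (-\<alpha>) \<le> 1 / 2" .
  have "stationary_jsq N cap (real N powr (-\<alpha>)) (\<sigma>\<^sub>a\<^sup>2 + \<sigma>\<^sub>s\<^sup>2) \<rho> input_law"
  proof
    show "i \<in> shortest_queues N x" if "(x, i) \<in> set_pmf \<rho>" for x i
      using that \<pi>(1) \<iota>(1) by (auto simp: \<rho>_def)
  qed (use N eps stationary input_law_arrivals_le input_law_services_le input_law_mean_arrivals
      input_law_mean_services input_law_second_moment in \<open>auto simp: cap_def\<close>)
  with fst show ?thesis by blast
qed

end

text \<open>The bound in \<open>jobs_char_bound\<close> with \<open>R = N\<^sup>3\<close>, divided by \<open>N \<epsilon>\<^sup>2\<close>.\<close>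
definition error_bound :: "real \<Rightarrow> real \<Rightarrow> real \<Rightarrow> real \<Rightarrow> real" where
  "error_bound \<alpha> C t n = \<bar>t\<bar> ^ 3 * C ^ 3 / 6 * n powr (2 - \<alpha>) + t\<^sup>2 * C / 2 * n powr (1 - \<alpha>)
    + t\<^sup>2 * n powr (4 - \<alpha>) + 4096 * \<bar>t\<bar> * C ^ 3 * (n powr (2 + \<alpha>) * exp (- (n / (64 * C\<^sup>2))))"

lemma error_bound_tendsto_0:
  assumes "\<alpha> > 4" "C \<ge> 1"
  shows "(\<lambda>N. error_bound \<alpha> C t (real N)) \<longlonglongrightarrow> 0"
proof -
  have powr: "(\<lambda>N. real N powr (b - \<alpha>)) \<longlonglongrightarrow> 0" if "b \<le> 4" for b
    using that assms by real_asymp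
  have "0 < 1 / (64 * C\<^sup>2)" using assms by simp
  then have "(\<lambda>N. real N powr (2 + \<alpha>) * exp (- (real N * (1 / (64 * C\<^sup>2))))) \<longlonglongrightarrow> 0"
    by real_asymp
  then have "(\<lambda>N. real N powr (2 + \<alpha>) * exp (- (real N / (64 * C\<^sup>2)))) \<longlonglongrightarrow> 0"
    by simp
  then show ?thesis
    unfolding error_bound_def
    by (intro tendsto_add_zero tendsto_mult_right_zero powr) auto
qed

context stationary_jsq
begin

lemma jobs_char_error_bound:
  assumes eps: "\<epsilon> = real N powr (-\<alpha>)"
  shows "cmod (jobs_char (t * \<epsilon>) * (\<i> * t + t\<^sup>2 / 2 * (v + N * \<epsilon>\<^sup>2)) - \<i> * t) \<le> error_bound \<alpha> C t N"
proof -
  define n where "n = real N"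
  have n: "0 < n" using N_pos by (simp add: n_def)
  have e: "0 < \<epsilon>" using N_pos by (simp add: eps)
  define D where "D = n * \<epsilon>\<^sup>2"
  have D: "0 < D" using n e by (simp add: D_def)
  have C: "0 < C" using C_ge_1 by simp
  have powr_eq: "n powr (b - \<alpha>) = n powr b * \<epsilon>" for b
    by (simp add: eps n_def powr_diff powr_minus divide_inverse)
  have powr_eq': "n powr (2 + \<alpha>) = n\<^sup>2 / \<epsilon>"
    using n by (simp add: eps n_def powr_add powr_minus field_simps)
  have powr_nat: "n powr 1 = n" "n powr 2 = n\<^sup>2" "n powr 4 = n ^ 4"
    using n by (simp_all add: powr_numeral)
  \<comment> \<open>At the threshold \<open>n ^ 3\<close> the exponent is linear in
    \<open>n\<close>, so the tail beats every power of \<open>n\<close>, including the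
    \<open>n powr (2 + \<alpha>)\<close> produced by the division by \<open>D\<close>.\<close>
  have eta: "1 / \<eta> = 64 * n\<^sup>2 * C\<^sup>2" "\<eta> * n ^ 3 = n / (64 * C\<^sup>2)"
    using n C by (simp_all add: \<eta>_def B_def n_def power_mult_distrib field_simps power2_eq_square power3_eq_cube)
  have tail: "32 / (\<eta> * exp (\<eta> * n ^ 3)) = 2048 * n\<^sup>2 * C\<^sup>2 * exp (- (n / (64 * C\<^sup>2)))"
  proof -
    have "32 / (\<eta> * exp (\<eta> * n ^ 3)) = 32 * (1 / \<eta>) * exp (- (\<eta> * n ^ 3))"
      by (simp add: exp_minus field_simps)
    then show ?thesis unfolding eta by simp
  qed
  let ?\<theta> = "t * \<epsilon>"
  have "of_real D * (jobs_char ?\<theta> * (\<i> * t + t\<^sup>2 / 2 * (v + N * \<epsilon>\<^sup>2)) - \<i> * t) =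
      jobs_char ?\<theta> * (\<i> * ?\<theta> * (N * \<epsilon>) + ?\<theta>\<^sup>2 / 2 * (N * v + (N * \<epsilon>)\<^sup>2)) - \<i> * ?\<theta> * (N * \<epsilon>)"
    by (simp add: D_def n_def power2_eq_square algebra_simps)
  then have "D * cmod (jobs_char ?\<theta> * (\<i> * t + t\<^sup>2 / 2 * (v + N * \<epsilon>\<^sup>2)) - \<i> * t) =
      cmod (jobs_char ?\<theta> * (\<i> * ?\<theta> * (N * \<epsilon>) + ?\<theta>\<^sup>2 / 2 * (N * v + (N * \<epsilon>)\<^sup>2)) - \<i> * ?\<theta> * (N * \<epsilon>))"
    using D by (metis abs_of_pos norm_mult norm_of_real)
  also have "\<dots> \<le> \<bar>?\<theta>\<bar> ^ 3 * (real N * C) ^ 3 / 6 + ?\<theta>\<^sup>2 * (real N * C) * (N * \<epsilon>) / 2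
      + (?\<theta>\<^sup>2 * (real N * n ^ 3) * (N * \<epsilon>) + 2 * \<bar>?\<theta>\<bar> * (real N * C) * (32 / (\<eta> * exp (\<eta> * n ^ 3))))"
    using n by (intro jobs_char_bound) auto
  also have "\<dots> = D * error_bound \<alpha> C t N"
    using n e C unfolding tail error_bound_def n_def[symmetric] powr_eq powr_eq' powr_nat
    by (simp add: D_def abs_mult field_simps power2_eq_square power3_eq_cube power4_eq_xxxx)
  finally show ?thesis using D by simp
qed

end

theorem theorem1:
  fixes \<alpha> \<sigma>\<^sub>a \<sigma>\<^sub>s A_max S_max :: real
    and M :: "nat \<Rightarrow> 'w measure"
    and a :: "nat \<Rightarrow> nat \<Rightarrow> 'w \<Rightarrow> nat"
    and s :: "nat \<Rightarrow> nat \<Rightarrow> nat \<Rightarrow> 'w \<Rightarrow> nat"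
    and istar :: "nat \<Rightarrow> nat \<Rightarrow> 'w \<Rightarrow> nat"
    and q :: "nat \<Rightarrow> nat \<Rightarrow> 'w \<Rightarrow> nat \<Rightarrow> nat"
    and E :: "nat \<Rightarrow> (nat \<Rightarrow> nat) set"
    and K :: "nat \<Rightarrow> (nat \<Rightarrow> nat) \<Rightarrow> (nat \<Rightarrow> nat) pmf"
    and P :: "nat \<Rightarrow> 'v measure"
    and q_bar :: "nat \<Rightarrow> 'v \<Rightarrow> nat \<Rightarrow> nat"
  assumes "\<alpha> > 4"
    and "\<And>N. N \<ge> 2 \<Longrightarrow>
      jsq_system (M N) N \<alpha> \<sigma>\<^sub>a \<sigma>\<^sub>s A_max S_max (a N) (s N) (istar N) (q N)"
    and "\<And>N. N \<ge> 2 \<Longrightarrow> markov_chain (M N) (E N) (K N) (q N)"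
    and "\<And>N. N \<ge> 2 \<Longrightarrow> irreducible_chain (E N) (K N)"
    and "\<And>N. N \<ge> 2 \<Longrightarrow> aperiodic_chain (E N) (K N)"
    and "\<And>N. N \<ge> 2 \<Longrightarrow> positive_recurrent_chain (E N) (K N)"
    and "\<And>N. N \<ge> 2 \<Longrightarrow> steady_state (E N) (K N) (P N) (q_bar N)"
  shows "weak_conv_m
    (\<lambda>N. distr (P N) borel (\<lambda>\<omega>. real N powr (-\<alpha>) * (\<Sum>i=1..N. real (q_bar N \<omega> i))))
    (density lborel (exponential_density (1 / ((\<sigma>\<^sub>a\<^sup>2 + \<sigma>\<^sub>s\<^sup>2) / 2))))"
proof -
  define v where "v = \<sigma>\<^sub>a\<^sup>2 + \<sigma>\<^sub>s\<^sup>2"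
  define C where "C = max 1 (max A_max S_max)"
  define Z where "Z N = distr (P N) borel (\<lambda>\<omega>. real N powr (-\<alpha>) * (\<Sum>i=1..N. real (q_bar N \<omega> i)))" for N
  let ?L = "density lborel (exponential_density (1 / (v / 2)))"
  \<comment> \<open>The system with two servers belongs to the sequence and already determines that
    \<open>\<sigma>\<^sub>a\<close> is nonzero.\<close>
  have "\<sigma>\<^sub>a \<noteq> 0"
    using jsq_system.sigma_a_nonzero[OF assms(2)[of 2]] assms(1) by simp
  then have v: "0 < v" unfolding v_def by (simp add: add_pos_nonneg)
  have L: "real_distribution ?L"
    using prob_space_exponential_density[of "1 / (v / 2)"] v
    by (simp add: real_distribution_def real_distribution_axioms_def)
  have Z: "real_distribution (Z N)" and
    char_Z: "cmod (char (Z N) t * (\<i> * t + t\<^sup>2 / 2 * (v + N * (real N powr (-\<alpha>))\<^sup>2)) - \<i> * t)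
      \<le> error_bound \<alpha> C t N" if N: "2 \<le> N" for N t
  proof -
    interpret J: jsq_system "M N" N \<alpha> \<sigma>\<^sub>a \<sigma>\<^sub>s A_max S_max "a N" "s N" "istar N" "q N"
      using N by (rule assms(2))
    obtain \<pi> where P: "prob_space (P N)" and meas: "q_bar N \<in> measurable (P N) (count_space UNIV)"
      and \<pi>: "stationary_distribution (E N) (K N) \<pi>" "distr (P N) (count_space UNIV) (q_bar N) = measure_pmf \<pi>"
      using assms(7)[OF N] unfolding steady_state_def by blast
    obtain \<rho> where fst: "map_pmf fst \<rho> = \<pi>" and
      stat: "stationary_jsq N J.cap (real N powr (-\<alpha>)) (\<sigma>\<^sub>a\<^sup>2 + \<sigma>\<^sub>s\<^sup>2) \<rho> J.input_law"
      using J.stationary_jsq_exists[OF N _ assms(3)[OF N] assms(4)[OF N] \<pi>(1)] assms(1) by auto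
    interpret S: stationary_jsq N J.cap "real N powr (-\<alpha>)" "\<sigma>\<^sub>a\<^sup>2 + \<sigma>\<^sub>s\<^sup>2" \<rho> J.input_law
      by (rule stat)
    have Y: "(\<lambda>\<omega>. real N powr (-\<alpha>) * jobs N (q_bar N \<omega>)) \<in> borel_measurable (P N)"
      by (rule measurable_compose[OF meas, of "\<lambda>x. real N powr (-\<alpha>) * jobs N x"]) simp
    have Z_eq: "Z N = distr (P N) borel (\<lambda>\<omega>. real N powr (-\<alpha>) * jobs N (q_bar N \<omega>))"
      by (simp add: Z_def jobs_def)
    show "real_distribution (Z N)"
      unfolding Z_eq by (rule prob_space.real_distribution_distr[OF P Y])
    let ?f = "\<lambda>x :: nat \<Rightarrow> nat. iexp (t * (real N powr (-\<alpha>) * jobs N x))"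
    have "char (Z N) t = integral\<^sup>L (P N) (\<lambda>\<omega>. ?f (q_bar N \<omega>))"
      unfolding Z_eq char_def by (rule integral_distr[OF Y]) simp
    also have "\<dots> = integral\<^sup>L (distr (P N) (count_space UNIV) (q_bar N)) ?f"
      by (rule integral_distr[OF meas, symmetric]) simp
    also have "\<dots> = S.jobs_char (t * real N powr (-\<alpha>))"
      unfolding \<pi>(2) fst[symmetric] S.jobs_char_def by (simp add: case_prod_unfold mult.assoc)
    finally have "char (Z N) t = S.jobs_char (t * real N powr (-\<alpha>))" .
    with S.jobs_char_error_bound[OF refl, of t]
    show "cmod (char (Z N) t * (\<i> * t + t\<^sup>2 / 2 * (v + N * (real N powr (-\<alpha>))\<^sup>2)) - \<i> * t)
        \<le> error_bound \<alpha> C t N"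
      by (simp add: v_def C_def J.cap_def)
  qed
  \<comment> \<open>The continuity theorem asks for a probability law at every index, while the
    systems start at \<open>N = 2\<close>; the shift is undone at the end.\<close>
  have "weak_conv_m (\<lambda>n. Z (n + 2)) ?L"
  proof (rule levy_continuity)
    show "real_distribution (Z (n + 2))" for n by (rule Z) simp
    show "real_distribution ?L" by (rule L)
    fix t :: real
    show "(\<lambda>n. char (Z (n + 2)) t) \<longlonglongrightarrow> char ?L t"
    \<comment> \<open>At \<open>t = 0\<close> the limit equation reads \<open>0 = 0\<close> and
      determines nothing, but characteristic functions take the value 1 there.\<close>
    proof (cases "t = 0")
      case True
      have "char (Z (n + 2)) 0 = 1" for n
        by (rule real_distribution.char_zero[OF Z]) simp
      moreover have "char ?L 0 = 1"
        by (rule real_distribution.char_zero[OF L])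
      ultimately show ?thesis using True by simp
    next
      case False
      define z where "z N = \<i> * t + t\<^sup>2 / 2 * (v + N * (real N powr (-\<alpha>))\<^sup>2)" for N :: nat
      define w where "w = \<i> * t + t\<^sup>2 / 2 * v"
      have z_nonzero: "z N \<noteq> 0" for N using False by (simp add: z_def complex_eq_iff)
      have w_nonzero: "w \<noteq> 0" using False by (simp add: w_def complex_eq_iff)
      have "(\<lambda>N. real N * (real N powr (-\<alpha>))\<^sup>2) \<longlonglongrightarrow> 0"
        using assms(1) by real_asymp
      then have "(\<lambda>N. t\<^sup>2 / 2 * (v + real N * (real N powr (-\<alpha>))\<^sup>2)) \<longlonglongrightarrow> t\<^sup>2 / 2 * (v + 0)"
        by (intro tendsto_intros)
      then have z_lim: "z \<longlonglongrightarrow> w"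
        unfolding z_def[abs_def] w_def by (intro tendsto_add tendsto_const tendsto_of_real) simp
      have "(\<lambda>N. char (Z N) t * z N - \<i> * t) \<longlonglongrightarrow> 0"
      proof (rule Lim_null_comparison)
        show "\<forall>\<^sub>F N in sequentially. cmod (char (Z N) t * z N - \<i> * t) \<le> error_bound \<alpha> C t N"
          using eventually_ge_at_top[of 2] by eventually_elim (simp only: z_def char_Z)
        show "(\<lambda>N. error_bound \<alpha> C t N) \<longlonglongrightarrow> 0"
          using assms(1) by (intro error_bound_tendsto_0) (auto simp: C_def)
      qed
      \<comment> \<open>The approximate equation is solved for the characteristic function; its
        coefficient \<open>z N\<close> has the nonzero limit \<open>w\<close>.\<close>
      then have "(\<lambda>N. (char (Z N) t * z N - \<i> * t + \<i> * t) / z N) \<longlonglongrightarrow> (0 + \<i> * t) / w"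
        using z_lim w_nonzero by (intro tendsto_intros)
      then have "(\<lambda>N. char (Z N) t) \<longlonglongrightarrow> \<i> * t / w"
        using z_nonzero by simp
      moreover have "char ?L t = \<i> * t / w"
      proof -
        have "char ?L t = (1 / (v / 2)) / (1 / (v / 2) - \<i> * t)"
          using v char_exponential[of "1 / (v / 2)" t] by simp
        \<comment> \<open>Multiplying numerator and denominator of the right-hand side by
          \<open>2 / (v * \<i> * t)\<close> gives the left-hand one.\<close>
        also have "\<dots> = \<i> * t / w"
        proof -
          have "complex_of_real v \<noteq> 0" using v by simp
          moreover have "2 / complex_of_real v - \<i> * t \<noteq> 0" using v by (auto simp: complex_eq_iff)
          ultimately show ?thesis
            using w_nonzero False by (simp add: w_def field_simps power2_eq_square)
        qed
        finally show ?thesis .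
      qed
      ultimately show ?thesis
        using LIMSEQ_ignore_initial_segment[of "\<lambda>N. char (Z N) t" _ 2] by simp
    qed
  qed
  then have "weak_conv_m Z ?L"
    unfolding weak_conv_m_def weak_conv_def by (blast intro: LIMSEQ_offset)
  then show ?thesis by (simp only: Z_def[abs_def] v_def)
qed

end
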